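(* Let $n\in\mathbb{N}$ and let $K$ be an arbitrary field. The Plactic algebra $K[M_n]$ of rank $n$ over $K$ admits a finite Gröbner–Shirshov basis over the generating set $C$ with respect to the degree-lexicographic order $\ll$ on $C^*$.
   Context: Let $n \in \mathbb{N}=\{1,2,\ldots\}$ and let $A = \{1<2<\cdots<n\}$. The Plactic monoid $M_n$ is the monoid presented by $\langle A \mid \mathcal{R}\rangle$, where $\mathcal{R} = \{(xzy,zxy) : x \le y < z\} \cup \{(yxz,yzx) : x<y\le z\}$ with $x,y,z\in A$. The Plactic algebra of rank $n$ over a field $K$ is the semigroup (monoid) algebra $K[M_n]$. A column is a strictly decreasing word in $A^*$. Let $C=\{c_\alpha : \alpha\text{ a non-empty column}\}$, a finite set of symbols; $c_\alpha$ represents the element of $M_n$ represented by the word $\alpha$, so that $C$ is a generating set for $M_n$. Order: fix a total order $\sqsubset$ on $C$ such that $c_\alpha\sqsubset c_\beta$ whenever $|\alpha|>|\beta|$ (where $|\cdot|$ is word length; ties between subscripts of equal length are broken arbitrarily). Let $\ll$ be the induced degree-lexicographic (length-plus-lexicographic) order on $C^*$: $c^{(1)}\cdots c^{(k)}\ll d^{(1)}\cdots d^{(l)}$ iff $k<l$, or $k=l$ and there is $i$ with $c^{(i)}\sqsubset d^{(i)}$ and $c^{(j)}=d^{(j)}$ for all $j<i$. Let $K[C^*]$ be the free associative $K$-algebra on $C$, and let $I$ be the kernel of the surjective algebra homomorphism $K[C^*]\to K[M_n]$ sending $c_\alpha$ to the element represented by $\alpha$. A Gröbner–Shirshov basis for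 $K[M_n]$ over $C$ with respect to $\ll$ is a set $G\subseteq I$ of nonzero elements generating $I$ as a two-sided ideal such that the $\ll$-leading word of every nonzero element of $I$ contains as a subword (contiguous factor) the $\ll$-leading word of some element of $G$. *)

theory Defs
  imports "HOL-Algebra.Ideal" "HOL-Algebra.Module" "HOL-Library.Sublist"
begin

subsection \<open>Free monoids and monoid presentations\<close>

definition free_monoid :: "'a set \<Rightarrow> 'a list monoid" where
  "free_monoid A = \<lparr>carrier = lists A, mult = (@), one = []\<rparr>"

text \<open>The least congruence on the free monoid over \<open>A\<close> that contains \<open>R\<close>.\<close>

inductive_set presented_cong :: "'a set \<Rightarrow> ('a list \<times> 'a list) set \<Rightarrow> ('a list \<times> 'a list) set"
  for A :: "'a set" and R :: "('a list \<times> 'a list) set" where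
  base: "(u, v) \<in> R \<Longrightarrow> u \<in> lists A \<Longrightarrow> v \<in> lists A \<Longrightarrow> (u, v) \<in> presented_cong A R"
| refl: "u \<in> lists A \<Longrightarrow> (u, u) \<in> presented_cong A R"
| sym: "(u, v) \<in> presented_cong A R \<Longrightarrow> (v, u) \<in> presented_cong A R"
| trans: "(u, v) \<in> presented_cong A R \<Longrightarrow> (v, w) \<in> presented_cong A R \<Longrightarrow> (u, w) \<in> presented_cong A R"
| append: "(u, v) \<in> presented_cong A R \<Longrightarrow> p \<in> lists A \<Longrightarrow> q \<in> lists A
    \<Longrightarrow> (p @ u @ q, p @ v @ q) \<in> presented_cong A R"

text \<open>The element represented by \<open>u\<close> is its class \<open>presented_cong A R `` {u}\<close>; the product of two
  classes is the class of the concatenation of any representatives.\<close>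

definition presented_monoid :: "'a set \<Rightarrow> ('a list \<times> 'a list) set \<Rightarrow> 'a list set monoid" where
  "presented_monoid A R =
     \<lparr>carrier = lists A // presented_cong A R,
      mult = (\<lambda>U V. \<Union>u\<in>U. \<Union>v\<in>V. presented_cong A R `` {u @ v}),
      one = presented_cong A R `` {[]}\<rparr>"


subsection \<open>Monoid algebras\<close>

text \<open>Elements are finitely supported functions into the scalars that vanish outside the monoid;
  multiplication is convolution, summed over the pairs of support elements with the given product.\<close>

definition monoid_algebra ::
    "('k, 'c) ring_scheme \<Rightarrow> ('m, 'd) monoid_scheme \<Rightarrow> ('k, 'm \<Rightarrow> 'k) module" where
  "monoid_algebra K M =
     \<lparr>carrier = {f. range f \<subseteq> carrier K \<and> finite {x. f x \<noteq> \<zero>\<^bsub>K\<^esub>} \<and> {x. f x \<noteq> \<zero>\<^bsub>K\<^esub>} \<subseteq> carrier M},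
      mult = (\<lambda>f g x. \<Oplus>\<^bsub>K\<^esub>p \<in> {(a, b). f a \<noteq> \<zero>\<^bsub>K\<^esub> \<and> g b \<noteq> \<zero>\<^bsub>K\<^esub> \<and> a \<otimes>\<^bsub>M\<^esub> b = x}.
                 f (fst p) \<otimes>\<^bsub>K\<^esub> g (snd p)),
      one = (\<lambda>x. if x = \<one>\<^bsub>M\<^esub> then \<one>\<^bsub>K\<^esub> else \<zero>\<^bsub>K\<^esub>),
      zero = (\<lambda>x. \<zero>\<^bsub>K\<^esub>),
      add = (\<lambda>f g x. f x \<oplus>\<^bsub>K\<^esub> g x),
      smult = (\<lambda>k f x. k \<otimes>\<^bsub>K\<^esub> f x)\<rparr>"

text \<open>The linear extension to monoid algebras of a map \<open>h\<close> between monoids.\<close>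

definition monoid_algebra_map ::
    "('k, 'c) ring_scheme \<Rightarrow> ('m \<Rightarrow> 'p) \<Rightarrow> ('m \<Rightarrow> 'k) \<Rightarrow> 'p \<Rightarrow> 'k" where
  "monoid_algebra_map K h f = (\<lambda>y. \<Oplus>\<^bsub>K\<^esub>x \<in> {x. f x \<noteq> \<zero>\<^bsub>K\<^esub> \<and> h x = y}. f x)"


subsection \<open>The Plactic monoid and its column generators\<close>

definition plactic_alphabet :: "nat \<Rightarrow> nat set" where
  "plactic_alphabet n = {1..n}"

definition plactic_relations :: "nat \<Rightarrow> (nat list \<times> nat list) set" where
  "plactic_relations n =
     {([x, z, y], [z, x, y]) | x y z.
        x \<in> plactic_alphabet n \<and> y \<in> plactic_alphabet n \<and> z \<in> plactic_alphabet n \<and> x \<le> y \<and> y < z}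
   \<union> {([y, x, z], [y, z, x]) | x y z.
        x \<in> plactic_alphabet n \<and> y \<in> plactic_alphabet n \<and> z \<in> plactic_alphabet n \<and> x < y \<and> y \<le> z}"

definition plactic_monoid :: "nat \<Rightarrow> nat list set monoid" where
  "plactic_monoid n = presented_monoid (plactic_alphabet n) (plactic_relations n)"

text \<open>The symbol \<open>c\<^sub>\<alpha>\<close> is identified with the column \<open>\<alpha>\<close> itself, so a word over the column
  generators is a list of columns.\<close>

definition columns :: "nat \<Rightarrow> nat list set" where
  "columns n = {\<alpha> \<in> lists (plactic_alphabet n). \<alpha> \<noteq> [] \<and> sorted_wrt (>) \<alpha>}"

text \<open>The element of the Plactic monoid represented by a word of columns; as a map on words this is
  the monoid homomorphism that sends \<open>c\<^sub>\<alpha>\<close> to the class of \<open>\<alpha>\<close>.\<close>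

definition column_eval :: "nat \<Rightarrow> nat list list \<Rightarrow> nat list set" where
  "column_eval n w =
     presented_cong (plactic_alphabet n) (plactic_relations n) `` {concat w}"

text \<open>Strict total orders on the columns in which longer columns come first. A pair \<open>(\<alpha>, \<beta>)\<close> in
  the relation means that \<open>\<alpha>\<close> is smaller than \<open>\<beta>\<close>. The induced degree-lexicographic order on words
  is the library's \<^const>\<open>lenlex\<close>.\<close>

definition column_order :: "nat \<Rightarrow> (nat list \<times> nat list) set \<Rightarrow> bool" where
  "column_order n r \<longleftrightarrow>
     r \<subseteq> columns n \<times> columns n \<and> strict_linear_order_on (columns n) r \<and>
     (\<forall>\<alpha>\<in>columns n. \<forall>\<beta>\<in>columns n. length \<alpha> > length \<beta> \<longrightarrow> (\<alpha>, \<beta>) \<in> r)"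


subsection \<open>Groebner--Shirshov bases\<close>

definition plactic_algebra :: "('k, 'c) ring_scheme \<Rightarrow> nat \<Rightarrow> ('k, nat list set \<Rightarrow> 'k) module" where
  "plactic_algebra K n = monoid_algebra K (plactic_monoid n)"

definition free_column_algebra ::
    "('k, 'c) ring_scheme \<Rightarrow> nat \<Rightarrow> ('k, nat list list \<Rightarrow> 'k) module" where
  "free_column_algebra K n = monoid_algebra K (free_monoid (columns n))"

definition plactic_ideal :: "('k, 'c) ring_scheme \<Rightarrow> nat \<Rightarrow> (nat list list \<Rightarrow> 'k) set" where
  "plactic_ideal K n =
     a_kernel (free_column_algebra K n) (plactic_algebra K n)
       (monoid_algebra_map K (column_eval n))"

text \<open>The largest word of the support; meaningful for nonzero \<open>f\<close> only.\<close>

definition leading_word ::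
    "('k, 'c) ring_scheme \<Rightarrow> ('a \<times> 'a) set \<Rightarrow> ('a list \<Rightarrow> 'k) \<Rightarrow> 'a list" where
  "leading_word K r f =
     (THE w. f w \<noteq> \<zero>\<^bsub>K\<^esub> \<and> (\<forall>v. f v \<noteq> \<zero>\<^bsub>K\<^esub> \<longrightarrow> v \<noteq> w \<longrightarrow> (v, w) \<in> lenlex r))"

text \<open>\<^const>\<open>genideal\<close> generates two-sided ideals.\<close>

definition groebner_shirshov_basis ::
    "('k, 'c) ring_scheme \<Rightarrow> nat \<Rightarrow> (nat list \<times> nat list) set \<Rightarrow> (nat list list \<Rightarrow> 'k) set \<Rightarrow> bool" where
  "groebner_shirshov_basis K n r G \<longleftrightarrow>
     G \<subseteq> plactic_ideal K n \<and>
     \<zero>\<^bsub>free_column_algebra K n\<^esub> \<notin> G \<and>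
     Idl\<^bsub>free_column_algebra K n\<^esub> G = plactic_ideal K n \<and>
     (\<forall>f \<in> plactic_ideal K n. f \<noteq> \<zero>\<^bsub>free_column_algebra K n\<^esub> \<longrightarrow>
        (\<exists>g\<in>G. sublist (leading_word K r g) (leading_word K r f)))"

end

theory Submission
  imports Defs "HOL-Library.Multiset"
begin

text \<open>
  Since the kernel ideal is spanned by differences of words representing the same element, everything
  reduces to a confluence statement: every word of columns is congruent to exactly one tableau, and
  the tableau is the least word of its class.

  A pair of columns \<open>\<alpha>\<beta>\<close> that is not a tableau is replaced by \<open>\<gamma>\<delta>\<close>, the result of column-inserting
  the letters of \<open>\<alpha>\<close>, from right to left, into \<open>\<beta>\<close>. Here \<open>\<gamma>\<close> is longer than \<open>\<alpha>\<close>, so \<open>\<gamma>\<delta>\<close> is smaller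
  in the order, and the finitely many differences \<open>\<alpha>\<beta> - \<gamma>\<delta>\<close> form the basis. Uniqueness of the tableau
  follows because congruent words, inserted into the same column, give the same column and bump
  congruent words: iterating, all columns of the tableau are invariants of the class.
\<close>

subsection \<open>Column insertion\<close>

text \<open>Insertion plays two roles. Plactic moves can carry it out, so straightening stays inside
  a class; and Plactic moves cannot change its outcome, so it also identifies the class. Uniqueness
  of the tableau therefore comes from an invariant, and no compositions (critical pairs) of basis
  elements are examined. The delicate point of the invariant is that bumping may turn one kind of
  defining relation into the other, so both kinds must be carried through together. The leading
  words are then handled without any division process: the leading word of a nonzero kernel element
  shares its class with a smaller word of the support, so it is not a tableau and contains a bad
  pair. Columns as generators are what makes the basis finite: there are finitely many of them, and
  failure to be a tableau shows in two adjacent ones. Placing longer columns first makes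
  straightening a descent. That the first column grows strictly follows from preservation of
  content: if it did not grow, the pair would have been a tableau already.\<close>

text \<open>A column is stored as the set of its letters. Inserting \<open>x\<close> bumps the least letter that is at
  least \<open>x\<close>; a word is inserted starting with its last letter.\<close>

definition bumped :: "nat \<Rightarrow> nat set \<Rightarrow> nat list" where
  "bumped x S = (if \<exists>s\<in>S. x \<le> s then [LEAST s. s \<in> S \<and> x \<le> s] else [])"

definition column_insert :: "nat \<Rightarrow> nat set \<Rightarrow> nat set" where
  "column_insert x S = insert x (S - set (bumped x S))"

primrec insert_word :: "nat list \<Rightarrow> nat set \<Rightarrow> nat set" where
  "insert_word [] S = S"
| "insert_word (x # w) S = column_insert x (insert_word w S)"

text \<open>The letter bumped first stands rightmost, so the result can be fed to the next column by
  the same right-to-left rule. This is also why \<open>bumped\<close> returns a list of length at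
  most one.\<close>

primrec bumped_word :: "nat list \<Rightarrow> nat set \<Rightarrow> nat list" where
  "bumped_word [] S = []"
| "bumped_word (x # w) S = bumped x (insert_word w S) @ bumped_word w S"

abbreviation plactic_cong :: "nat \<Rightarrow> (nat list \<times> nat list) set" where
  "plactic_cong n \<equiv> presented_cong (plactic_alphabet n) (plactic_relations n)"

lemma bumped_eq_Nil_iff: "bumped x S = [] \<longleftrightarrow> (\<forall>s\<in>S. s < x)"
  by (auto simp: bumped_def simp flip: not_le)

lemma bumped_eq_singleton_iff:
  "bumped x S = [y] \<longleftrightarrow> y \<in> S \<and> x \<le> y \<and> (\<forall>s\<in>S. x \<le> s \<longrightarrow> y \<le> s)" (is "?l \<longleftrightarrow> ?r")
proof
  assume ?l
  then have ex: "\<exists>s. s \<in> S \<and> x \<le> s" and y: "y = (LEAST s. s \<in> S \<and> x \<le> s)"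
    by (auto simp: bumped_def split: if_splits)
  show ?r
    using LeastI_ex[OF ex] Least_le[of "\<lambda>s. s \<in> S \<and> x \<le> s"] unfolding y by blast
next
  assume ?r
  moreover from this have "(LEAST s. s \<in> S \<and> x \<le> s) = y"
    by (intro Least_equality) auto
  ultimately show ?l by (auto simp: bumped_def)
qed

lemma bumped_cases:
  obtains "bumped x S = []" "\<forall>s\<in>S. s < x"
  | y where "bumped x S = [y]" "y \<in> S" "x \<le> y" "\<forall>s\<in>S. x \<le> s \<longrightarrow> y \<le> s"
proof (cases "bumped x S = []")
  case True
  then show ?thesis using that(1) bumped_eq_Nil_iff by blast
next
  case False
  then obtain y where "bumped x S = [y]" by (auto simp: bumped_def split: if_splits)
  then show ?thesis using that(2) bumped_eq_singleton_iff by blast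
qed

lemma bumped_cong:
  assumes "\<And>s. s \<in> S \<and> x \<le> s \<longleftrightarrow> s \<in> T \<and> y \<le> s"
  shows "bumped x S = bumped y T"
  unfolding bumped_def Bex_def assms ..

lemma insert_word_append: "insert_word (u @ v) S = insert_word u (insert_word v S)"
  by (induction u) auto

lemma bumped_word_append:
  "bumped_word (u @ v) S = bumped_word u (insert_word v S) @ bumped_word v S"
  by (induction u) (auto simp: insert_word_append)

lemma set_bumped_subset: "set (bumped x S) \<subseteq> S"
  by (rule bumped_cases[of x S]) auto

lemma insert_word_subset: "insert_word w S \<subseteq> set w \<union> S"
  by (induction w) (auto simp: column_insert_def)

lemma set_bumped_word_subset: "set (bumped_word w S) \<subseteq> set w \<union> S"
  by (induction w) (use set_bumped_subset insert_word_subset in fastforce)+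

section \<open>Invariance of insertion under the Plactic relations\<close>

lemma presented_cong_lists:
  "(u, v) \<in> presented_cong A R \<Longrightarrow> u \<in> lists A \<and> v \<in> lists A"
  by (induction rule: presented_cong.induct) auto

lemma presented_cong_append:
  assumes "(u, u') \<in> presented_cong A R" "(v, v') \<in> presented_cong A R"
  shows "(u @ v, u' @ v') \<in> presented_cong A R"
proof -
  have l: "v \<in> lists A" "u' \<in> lists A" using assms presented_cong_lists by blast+
  have "([] @ u @ v, [] @ u' @ v) \<in> presented_cong A R"
    using assms(1) l by (intro presented_cong.append) auto
  moreover have "(u' @ v @ [], u' @ v' @ []) \<in> presented_cong A R"
    using assms(2) l by (intro presented_cong.append) auto
  ultimately show ?thesis by (auto intro: presented_cong.trans)
qed

lemma plactic_cong1:
  assumes "x \<le> y" "y < z" "{x, y, z} \<subseteq> plactic_alphabet n"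
  shows "([x, z, y], [z, x, y]) \<in> plactic_cong n"
  using assms by (intro presented_cong.base) (auto simp: plactic_relations_def)

lemma plactic_cong2:
  assumes "x < y" "y \<le> z" "{x, y, z} \<subseteq> plactic_alphabet n"
  shows "([y, x, z], [y, z, x]) \<in> plactic_cong n"
  using assms by (intro presented_cong.base) (auto simp: plactic_relations_def)

text \<open>The bumped words are equal or again related by a defining relation, possibly of the other kind.\<close>

lemma insert_relation1:
  assumes xyz: "x \<le> y" "y < z" "{x, y, z} \<subseteq> plactic_alphabet n" and S: "S \<subseteq> plactic_alphabet n"
  shows "insert_word [x, z, y] S = insert_word [z, x, y] S
     \<and> (bumped_word [x, z, y] S, bumped_word [z, x, y] S) \<in> plactic_cong n"
proof -
  define S1 where "S1 = column_insert y S"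
  \<comment> \<open>Since y is now in the column, x bumps some t \<le> y, while z can only bump
    letters above y. The insertions of x and z therefore do not interfere, in either order.\<close>
  have y1: "y \<in> S1" by (auto simp: S1_def column_insert_def)
  then obtain t where t: "bumped x S1 = [t]" "t \<in> S1" "x \<le> t" "t \<le> y" "\<forall>s\<in>S1. x \<le> s \<longrightarrow> t \<le> s"
    by (cases rule: bumped_cases[of x S1]) (use xyz in auto)
  have S1A: "S1 \<subseteq> plactic_alphabet n"
    using S xyz by (auto simp: S1_def column_insert_def)
  show ?thesis
  proof (cases rule: bumped_cases[of z S1])
    case 1
    have a: "bumped x (column_insert z S1) = [t]"
      unfolding bumped_eq_singleton_iff using t xyz 1 by (auto simp: column_insert_def)
    have b: "bumped z (column_insert x S1) = []"
      unfolding bumped_eq_Nil_iff using t xyz 1 by (auto simp: column_insert_def)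
    have "bumped_word [x, z, y] S \<in> lists (plactic_alphabet n)"
      using set_bumped_word_subset[of "[x, z, y]" S] S xyz by auto
    moreover have "column_insert x (column_insert z S1) = column_insert z (column_insert x S1)"
      using t xyz 1 unfolding column_insert_def[of x "column_insert z S1"]
        column_insert_def[of z "column_insert x S1"] a b by (auto simp: column_insert_def)
    ultimately show ?thesis using a b t 1 by (simp add: S1_def presented_cong.refl)
  next
    case (2 s)
    have a: "bumped x (column_insert z S1) = [t]"
      unfolding bumped_eq_singleton_iff using t xyz 2 by (auto simp: column_insert_def)
    have b: "bumped z (column_insert x S1) = [s]"
      unfolding bumped_eq_singleton_iff using t xyz 2 by (auto simp: column_insert_def)
    have "s \<in> S" using 2 xyz by (auto simp: S1_def column_insert_def)
    then obtain s0 where s0: "bumped y S = [s0]" "s0 \<in> S" "y \<le> s0" "s0 \<le> s"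
      by (cases rule: bumped_cases[of y S]) (use xyz 2 in auto)
    \<comment> \<open>After y has been inserted, s is still in the column and differs from y, so it
      is not the letter that y bumped. Hence t \<le> y \<le> s0 < s, and the relation of the first
      kind is reproduced.\<close>
    have "s0 \<noteq> s" using 2 s0 xyz by (auto simp: S1_def column_insert_def)
    then have "([t, s, s0], [s, t, s0]) \<in> plactic_cong n"
      using s0 t 2 S S1A by (intro plactic_cong1) auto
    moreover have "column_insert x (column_insert z S1) = column_insert z (column_insert x S1)"
      using t xyz 2 unfolding column_insert_def[of x "column_insert z S1"]
        column_insert_def[of z "column_insert x S1"] a b by (auto simp: column_insert_def)
    ultimately show ?thesis using a b t 2 s0 by (simp add: S1_def)
  qed
qed

lemma insert_relation2:
  assumes xyz: "x < y" "y \<le> z" "{x, y, z} \<subseteq> plactic_alphabet n" and S: "S \<subseteq> plactic_alphabet n"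
  shows "insert_word [y, x, z] S = insert_word [y, z, x] S
     \<and> (bumped_word [y, x, z] S, bumped_word [y, z, x] S) \<in> plactic_cong n"
proof -
  have la: "bumped_word [y, x, z] S \<in> lists (plactic_alphabet n)"
      using set_bumped_word_subset[of "[y, x, z]" S] S xyz by auto
  show ?thesis
  \<comment> \<open>If S has a letter in the interval from x to below z, then x and z act on
    different letters; otherwise they compete for the same one.\<close>
  proof (cases "\<exists>s\<in>S. x \<le> s \<and> s < z")
    case True
    then obtain t where t: "bumped x S = [t]" "t \<in> S" "x \<le> t" "t < z" "\<forall>s\<in>S. x \<le> s \<longrightarrow> t \<le> s"
      by (cases rule: bumped_cases[of x S]) fastforce+
    have tz: "bumped x (column_insert z S) = [t]"
      unfolding bumped_eq_singleton_iff column_insert_def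
      by (rule bumped_cases[of z S]) (use t in auto)
    have zx: "bumped z (column_insert x S) = bumped z S"
      by (rule bumped_cong) (use t xyz in \<open>auto simp: column_insert_def\<close>)
    have comm: "column_insert x (column_insert z S) = column_insert z (column_insert x S)"
      using t xyz unfolding column_insert_def[of x "column_insert z S"]
         column_insert_def[of z "column_insert x S"] tz zx
      by (cases rule: bumped_cases[of z S]) (auto simp: column_insert_def)
    define S2 where "S2 = column_insert x (column_insert z S)"
    have S2: "S2 = insert x (column_insert z S - {t})"
      by (simp add: S2_def column_insert_def[of x] tz)
    have "z \<in> S2" using t by (auto simp: S2 column_insert_def)
    then obtain q where q: "bumped y S2 = [q]" "q \<in> S2" "y \<le> q" "q \<le> z" "\<forall>s\<in>S2. y \<le> s \<longrightarrow> q \<le> s"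
      by (cases rule: bumped_cases[of y S2]) (use xyz in auto)
    have tq: "t < q"
      using q t xyz by (auto simp: S2 column_insert_def not_less)
    have qA: "q \<in> plactic_alphabet n"
      using q S xyz by (auto simp: S2 column_insert_def)
    show ?thesis
    proof (cases rule: bumped_cases[of z S])
      case 1
      then show ?thesis using tz zx comm q t la
        by (auto simp: S2_def intro: presented_cong.refl)
    next
      case (2 s)
      \<comment> \<open>Here t < q \<le> z \<le> s, because z is still in the column when y arrives.
        The relation of the second kind is reproduced.\<close>
      have "([q, t, s], [q, s, t]) \<in> plactic_cong n"
        using tq q 2 t S xyz qA by (intro plactic_cong2) auto
      then show ?thesis using tz zx comm q t 2 by (auto simp: S2_def)
    qed
  next
    \<comment> \<open>Now z followed by x bumps z itself, leaving x in the column; x followed by z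
      bumps the next letter s of the column, if any, and y then bumps z. The bumped words are s z s0
      and z s s0 with z \<le> s0 < s, a relation of the first kind, or they coincide when there is
      no such s.\<close>
    case False
    then have F: "\<forall>s\<in>S. x \<le> s \<longrightarrow> z \<le> s" by auto
    have xz: "bumped x S = bumped z S"
      by (rule bumped_cong) (use F xyz in force)
    have b1: "bumped x (column_insert z S) = [z]"
      unfolding bumped_eq_singleton_iff column_insert_def
      by (rule bumped_cases[of z S]) (use F xyz in auto)
    define S' where "S' = S - set (bumped z S)"
    have S': "\<forall>s\<in>S'. x \<le> s \<longrightarrow> z < s"
      unfolding S'_def by (rule bumped_cases[of z S]) (use F xyz in auto, force)
    have c1: "column_insert z S = insert z S'" "column_insert x S = insert x S'"
      by (simp_all add: column_insert_def S'_def xz)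
    have c2: "column_insert x (insert z S') = insert x S'"
      using S' b1 xyz by (auto simp: column_insert_def[of x] c1)
    have b2: "bumped z (insert x S') = bumped y (insert x S')"
      by (rule bumped_cong) (use S' xyz in force)
    have b3: "bumped y (column_insert z (insert x S')) = [z]"
      unfolding bumped_eq_singleton_iff column_insert_def
      by (rule bumped_cases[of z "insert x S'"]) (use S' xyz in auto)
    have c3: "column_insert y (column_insert z (insert x S')) = column_insert y (insert x S')"
      unfolding column_insert_def[of y] b3 unfolding column_insert_def b2
      using xyz S' set_bumped_subset[of y "insert x S'"] by auto
    have "(bumped y (insert x S') @ [z] @ bumped z S, [z] @ bumped z (insert x S') @ bumped z S)
       \<in> plactic_cong n"
    proof (cases rule: bumped_cases[of z "insert x S'"])
      case 1
      have "z # bumped z S \<in> lists (plactic_alphabet n)"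
        using set_bumped_subset[of z S] S xyz by auto
      then show ?thesis using 1 b2 by (simp add: presented_cong.refl)
    next
      case (2 s)
      then have s: "s \<in> S'" "z < s" using S' xyz by auto
      \<comment> \<open>A letter bumped by the second of the two insertions, being above z,
        guarantees that the first one bumped a letter too.\<close>
      then have "s \<in> S" by (auto simp: S'_def)
      then obtain s0 where s0: "bumped z S = [s0]" "s0 \<in> S" "z \<le> s0" "s0 \<le> s"
        by (cases rule: bumped_cases[of z S]) (use s in auto)
      have "s0 \<noteq> s" using s s0 by (auto simp: S'_def)
      then have "([z, s, s0], [s, z, s0]) \<in> plactic_cong n"
        using s0 s S xyz by (intro plactic_cong1) (auto simp: S'_def)
      then show ?thesis using 2 b2 s0 by (auto intro: presented_cong.sym)
    qed
    then show ?thesis using b1 c1 c2 b2 b3 c3 xz by (simp add: c1 c2)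
  qed
qed

text \<open>In the context case p u q, the word u meets the column already changed by q, so S must
  be arbitrary; and because u and v leave the same column, p bumps the very same word on both
  sides.\<close>

lemma plactic_cong_insert_word:
  assumes "(u, v) \<in> plactic_cong n" "S \<subseteq> plactic_alphabet n"
  shows "insert_word u S = insert_word v S \<and> (bumped_word u S, bumped_word v S) \<in> plactic_cong n"
  using assms
proof (induction arbitrary: S rule: presented_cong.induct)
  case (base u v)
  then consider x y z where "u = [x, z, y]" "v = [z, x, y]" "x \<le> y" "y < z" "{x, y, z} \<subseteq> plactic_alphabet n"
    | x y z where "u = [y, x, z]" "v = [y, z, x]" "x < y" "y \<le> z" "{x, y, z} \<subseteq> plactic_alphabet n"
    by (force simp: plactic_relations_def)
  then show ?case
  proof cases
    case 1
    show ?thesis unfolding 1(1,2) using 1(3-5) base.prems by (rule insert_relation1)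
  next
    case 2
    show ?thesis unfolding 2(1,2) using 2(3-5) base.prems by (rule insert_relation2)
  qed
next
  case (refl u)
  have "bumped_word u S \<in> lists (plactic_alphabet n)"
    using set_bumped_word_subset[of u S] refl by auto
  then show ?case by (auto intro: presented_cong.refl)
next
  case (append u v p q)
  define S' where "S' = insert_word q S"
  have S': "S' \<subseteq> plactic_alphabet n"
    using insert_word_subset[of q S] append.hyps append.prems by (auto simp: S'_def)
  define S'' where "S'' = insert_word u S'"
  have S'': "S'' \<subseteq> plactic_alphabet n" "insert_word v S' = S''"
    using insert_word_subset[of u S'] presented_cong_lists[OF append.hyps(1)] S' append.IH[OF S']
    by (auto simp: S''_def)
  have "bumped_word p S'' \<in> lists (plactic_alphabet n)" "bumped_word q S \<in> lists (plactic_alphabet n)"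
    using set_bumped_word_subset[of p S''] set_bumped_word_subset[of q S] append.hyps append.prems S''
    by auto
  then have "(bumped_word p S'' @ bumped_word u S' @ bumped_word q S,
     bumped_word p S'' @ bumped_word v S' @ bumped_word q S) \<in> plactic_cong n"
    using append.IH[OF S'] by (intro presented_cong.append) auto
  then show ?case using S''(2)
    by (simp add: insert_word_append bumped_word_append S'_def S''_def)
qed (blast intro: presented_cong.sym presented_cong.trans)+

subsection \<open>Straightening and tableaux\<close>

definition column_of :: "nat set \<Rightarrow> nat list" where
  "column_of S = rev (sorted_list_of_set S)"

lemma column_of_set: "sorted_wrt (>) \<alpha> \<Longrightarrow> column_of (set \<alpha>) = \<alpha>"
proof -
  assume "sorted_wrt (>) \<alpha>"
  then have "sorted_wrt (<) (rev \<alpha>)" by (simp add: sorted_wrt_rev)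
  then have "sorted_list_of_set (set (rev \<alpha>)) = rev \<alpha>"
    by (intro sorted_list_of_set.idem_if_sorted_distinct) (auto simp: strict_sorted_iff)
  then show ?thesis by (simp add: column_of_def)
qed

lemma
  assumes "finite S"
  shows set_column_of: "set (column_of S) = S"
    and sorted_column_of: "sorted_wrt (>) (column_of S)"
    and length_column_of: "length (column_of S) = card S"
  using assms by (auto simp: column_of_def sorted_wrt_rev)

section \<open>Column insertion carried out by Plactic moves\<close>

lemma finite_plactic_alphabet: "finite (plactic_alphabet n)"
  by (simp add: plactic_alphabet_def)

lemma presented_cong_Cons:
  assumes "(u, v) \<in> presented_cong A R" "x \<in> A"
  shows "(x # u, x # v) \<in> presented_cong A R"
  using presented_cong.append[OF assms(1), of "[x]" "[]"] assms(2) by simp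

text \<open>The first relation exchanges x and b in front of a letter h with x \<le> h < b; the
  letter following b in U y always qualifies.\<close>

lemma plactic_cong_move_right:
  assumes "x \<le> y" "\<forall>b\<in>set U. y < b" "sorted_wrt (>) U"
    and "x \<in> plactic_alphabet n" "y \<in> plactic_alphabet n" "set U \<subseteq> plactic_alphabet n"
  shows "(x # U @ [y], U @ [x, y]) \<in> plactic_cong n"
  using assms
proof (induction U)
  case Nil
  then show ?case by (auto intro!: presented_cong.refl)
next
  case (Cons b U)
  obtain h t where ht: "U @ [y] = h # t" by (cases U) auto
  then have h: "h \<in> set U \<or> h = y" "set t \<subseteq> set U \<union> {y}" by (cases U; auto)+
  have "([x, b, h], [b, x, h]) \<in> plactic_cong n"
    using h Cons.prems by (intro plactic_cong1) auto
  moreover have "t \<in> lists (plactic_alphabet n)" using h Cons.prems by auto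
  ultimately have "([x, b, h] @ t, [b, x, h] @ t) \<in> plactic_cong n"
    by (intro presented_cong_append) (auto intro: presented_cong.refl)
  then have "(x # (b # U) @ [y], b # x # U @ [y]) \<in> plactic_cong n"
    using ht by simp
  moreover have "(b # x # U @ [y], b # U @ [x, y]) \<in> plactic_cong n"
    using Cons by (intro presented_cong_Cons) auto
  ultimately show ?case by (auto intro: presented_cong.trans)
qed

text \<open>The second relation moves y past l behind a letter x with l < x \<le> y. After the move
  l itself is the letter standing before y, so the induction generalises over x.\<close>

lemma plactic_cong_move_past:
  assumes "x \<le> y" "\<forall>b\<in>set L. b < x" "sorted_wrt (>) L"
    and "x \<in> plactic_alphabet n" "y \<in> plactic_alphabet n" "set L \<subseteq> plactic_alphabet n"
  shows "(x # y # L, x # L @ [y]) \<in> plactic_cong n"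
  using assms
proof (induction L arbitrary: x)
  case Nil
  then show ?case by (auto intro!: presented_cong.refl)
next
  case (Cons l L)
  have "([x, y, l], [x, l, y]) \<in> plactic_cong n"
    using Cons.prems by (intro presented_cong.sym[OF plactic_cong2]) auto
  moreover have "L \<in> lists (plactic_alphabet n)" using Cons.prems by auto
  ultimately have "([x, y, l] @ L, [x, l, y] @ L) \<in> plactic_cong n"
    by (intro presented_cong_append) (auto intro: presented_cong.refl)
  then have "(x # y # l # L, x # l # y # L) \<in> plactic_cong n" by simp
  moreover have "(x # l # y # L, x # l # L @ [y]) \<in> plactic_cong n"
    using Cons.prems by (intro presented_cong_Cons Cons.IH) auto
  ultimately show ?case by (auto intro: presented_cong.trans)
qed

text \<open>Let y be the bumped letter and U y L the column. All of L is below x, because y is the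
  least letter that is at least x. The moves are x U y L to U x y L to U x L y.\<close>

lemma plactic_cong_column_insert:
  assumes S: "S \<subseteq> plactic_alphabet n" and x: "x \<in> plactic_alphabet n"
  shows "(x # column_of S, column_of (column_insert x S) @ bumped x S) \<in> plactic_cong n"
proof -
  have fin: "finite S" using S finite_plactic_alphabet finite_subset by blast
  note col = set_column_of[OF fin] sorted_column_of[OF fin]
  show ?thesis
  proof (cases rule: bumped_cases[of x S])
    case 1
    then have "column_of (set (x # column_of S)) = x # column_of S"
      using col by (intro column_of_set) auto
    then have "column_of (column_insert x S) = x # column_of S"
      using 1 col by (simp add: column_insert_def)
    then show ?thesis using 1 S x col by (auto intro!: presented_cong.refl)
  next
    case (2 y)
    then have "y \<in> set (column_of S)" using col by simp
    then obtain U L where UL: "column_of S = U @ y # L" by (meson split_list)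
    have srt: "sorted_wrt (>) U" "sorted_wrt (>) L" "\<forall>b\<in>set U. y < b" "\<forall>b\<in>set L. b < y"
      "\<forall>b\<in>set U. \<forall>c\<in>set L. c < b"
      using col(2) unfolding UL by (auto simp: sorted_wrt_append)
    have setS: "S = set U \<union> {y} \<union> set L" using col(1) UL by auto
    have Lx: "\<forall>b\<in>set L. b < x" using 2(4) srt(4) unfolding setS by (metis UnCI not_le)
    have "column_of (set (U @ x # L)) = U @ x # L"
      using srt Lx 2 by (intro column_of_set) (auto simp: sorted_wrt_append)
    moreover have "set (U @ x # L) = column_insert x S"
      using 2 srt setS by (auto simp: column_insert_def)
    ultimately have ci: "column_of (column_insert x S) = U @ x # L" by simp
    have A: "set U \<subseteq> plactic_alphabet n" "set L \<subseteq> plactic_alphabet n" "y \<in> plactic_alphabet n"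
      using S setS by auto
    have right: "((x # U @ [y]) @ L, (U @ [x, y]) @ L) \<in> plactic_cong n"
      using A x 2 srt
      by (intro presented_cong_append plactic_cong_move_right presented_cong.refl) auto
    have past: "(U @ x # y # L, U @ x # L @ [y]) \<in> plactic_cong n"
      using A x 2 srt Lx
      by (intro presented_cong_append plactic_cong_move_past presented_cong.refl) auto
    have "((x # U @ [y]) @ L, U @ x # L @ [y]) \<in> plactic_cong n"
      by (rule presented_cong.trans[OF right]) (use past in simp)
    then show ?thesis using UL ci 2 by simp
  qed
qed

lemma plactic_cong_insert_word_bumped_word:
  assumes "S \<subseteq> plactic_alphabet n" "set w \<subseteq> plactic_alphabet n"
  shows "(w @ column_of S, column_of (insert_word w S) @ bumped_word w S) \<in> plactic_cong n"
  using assms(2)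
proof (induction w)
  case Nil
  have "finite S" using assms(1) finite_plactic_alphabet finite_subset by blast
  then show ?case using assms(1) by (auto simp: set_column_of intro!: presented_cong.refl)
next
  case (Cons x w)
  define S' where "S' = insert_word w S"
  have "set w \<union> S \<subseteq> plactic_alphabet n" using Cons.prems assms(1) by auto
  then have S': "S' \<subseteq> plactic_alphabet n" "set (bumped_word w S) \<subseteq> plactic_alphabet n"
    using insert_word_subset[of w S] set_bumped_word_subset[of w S] unfolding S'_def by blast+
  have 1: "(x # w @ column_of S, x # column_of S' @ bumped_word w S) \<in> plactic_cong n"
    using Cons by (intro presented_cong_Cons) (auto simp: S'_def)
  have "((x # column_of S') @ bumped_word w S,
      (column_of (column_insert x S') @ bumped x S') @ bumped_word w S) \<in> plactic_cong n"
    using S' Cons.prems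
    by (intro presented_cong_append plactic_cong_column_insert presented_cong.refl) auto
  then show ?case using presented_cong.trans[OF 1] by (simp add: S'_def)
qed

section \<open>Inserting a column into a column\<close>

lemma plactic_cong_mset: "(u, v) \<in> plactic_cong n \<Longrightarrow> mset u = mset v"
  by (induction rule: presented_cong.induct) (auto simp: plactic_relations_def)

text \<open>Read from the right, a decreasing word is inserted in increasing order, and a letter
  bumps only letters at least as large as itself, so earlier ones stay.\<close>

lemma insert_word_supset: "sorted_wrt (>) \<alpha> \<Longrightarrow> set \<alpha> \<subseteq> insert_word \<alpha> S"
proof (induction \<alpha>)
  case (Cons a \<alpha>)
  then show ?case
    by (cases rule: bumped_cases[of a "insert_word \<alpha> S"]) (auto simp: column_insert_def subset_iff)
qed simp

text \<open>The second conjunct is the invariant behind the first: the next bumped letter y is at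
  least the new letter, hence above all letters inserted before, and so exceeds everything bumped
  before.\<close>

lemma sorted_bumped_word:
  assumes "sorted_wrt (>) \<alpha>"
  shows "sorted_wrt (>) (bumped_word \<alpha> S)
    \<and> (\<forall>e\<in>set (bumped_word \<alpha> S). \<forall>s\<in>insert_word \<alpha> S. (\<forall>a\<in>set \<alpha>. a < s) \<longrightarrow> e < s)"
  using assms
proof (induction \<alpha>)
  case (Cons a \<alpha>)
  then have IH: "sorted_wrt (>) (bumped_word \<alpha> S)" "\<forall>b\<in>set \<alpha>. b < a"
    "\<And>e s. e \<in> set (bumped_word \<alpha> S) \<Longrightarrow> s \<in> insert_word \<alpha> S \<Longrightarrow> \<forall>b\<in>set \<alpha>. b < s \<Longrightarrow> e < s"
    by auto
  show ?case
  proof (cases rule: bumped_cases[of a "insert_word \<alpha> S"])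
    case 1
    then show ?thesis using IH(1,3) by (auto simp: column_insert_def)
  next
    case (2 y)
    have "e < y" if "e \<in> set (bumped_word \<alpha> S)" for e
      using IH(3)[OF that 2(2)] IH(2) 2(3) by (meson less_le_trans)
    moreover have "y < s" if "s \<in> insert_word \<alpha> S - {y}" "a < s" for s
      using 2(4) that by (auto simp: nat_less_le)
    ultimately show ?thesis using 2(1) IH(1,3) by (auto simp: column_insert_def)
  qed
qed simp

lemma insert_word_empty:
  assumes "sorted_wrt (>) \<alpha>"
  shows "insert_word \<alpha> {} = set \<alpha> \<and> bumped_word \<alpha> {} = []"
  using assms
proof (induction \<alpha>)
  case (Cons a \<alpha>)
  then have "bumped a (set \<alpha>) = []" by (auto simp: bumped_eq_Nil_iff)
  then show ?case using Cons by (simp add: column_insert_def)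
qed simp

text \<open>For columns, this says that \<open>\<alpha>\<close> and \<open>\<beta>\<close> are adjacent columns of a semistandard tableau.\<close>

definition tableau_pair :: "nat list \<Rightarrow> nat list \<Rightarrow> bool" where
  "tableau_pair \<alpha> \<beta> \<longleftrightarrow> insert_word \<alpha> (set \<beta>) = set \<alpha> \<and> bumped_word \<alpha> (set \<beta>) = \<beta>"

abbreviation tableau :: "nat list list \<Rightarrow> bool" where
  "tableau w \<equiv> successively tableau_pair w"

lemma columns_iff:
  "\<alpha> \<in> columns n \<longleftrightarrow> set \<alpha> \<subseteq> plactic_alphabet n \<and> \<alpha> \<noteq> [] \<and> sorted_wrt (>) \<alpha>"
  by (auto simp: columns_def)

lemma concat_columns: "w \<in> lists (columns n) \<Longrightarrow> concat w \<in> lists (plactic_alphabet n)"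
  by (induction w) (auto simp: columns_iff)

text \<open>A decreasing word is determined by its set of letters.\<close>

lemma finite_columns: "finite (columns n)"
proof (rule finite_subset)
  show "columns n \<subseteq> column_of ` Pow (plactic_alphabet n)"
    by (auto simp: columns_iff column_of_set intro!: image_eqI[where f = column_of and x = "set _"])
qed (simp add: finite_plactic_alphabet)

text \<open>By induction the tail leaves its first column d in place and bumps out the word of the
  columns after d. Inserting c then replaces d by c and bumps exactly d, which completes the word of
  the tail.\<close>

lemma insert_word_tableau:
  assumes "w \<in> lists (columns n)" "tableau w"
  shows "insert_word (concat w) {} = (if w = [] then {} else set (hd w))
    \<and> bumped_word (concat w) {} = concat (tl w)"
  using assms
proof (induction w)
  case (Cons c w)
  then have c: "sorted_wrt (>) c" by (auto simp: columns_iff)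
  show ?case
  proof (cases w)
    case Nil
    then show ?thesis using insert_word_empty[OF c] by simp
  next
    case (Cons d w')
    then show ?thesis using Cons.IH Cons.prems
      by (auto simp: insert_word_append bumped_word_append tableau_pair_def)
  qed
qed simp

lemma tableau_unique:
  assumes "w \<in> lists (columns n)" "tableau w" "v \<in> lists (columns n)" "tableau v"
    and "(concat w, concat v) \<in> plactic_cong n"
  shows "w = v"
  using assms
proof (induction w arbitrary: v rule: list.induct)
  case Nil
  then have "insert_word (concat v) {} = {}"
    using plactic_cong_insert_word[OF Nil(5), of "{}"] by simp
  then show ?case using insert_word_tableau[OF Nil(3,4)] Nil(3)
    by (cases v) (auto simp: columns_iff)
next
  case (Cons c w)
  have eq: "insert_word (concat (c # w)) {} = insert_word (concat v) {}"
    "(bumped_word (concat (c # w)) {}, bumped_word (concat v) {}) \<in> plactic_cong n"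
    using plactic_cong_insert_word[OF Cons.prems(5), of "{}"] by auto
  note tc = insert_word_tableau[OF Cons.prems(1,2)] and tv = insert_word_tableau[OF Cons.prems(3,4)]
  have c: "c \<in> columns n" using Cons.prems(1) by simp
  then have "insert_word (concat v) {} \<noteq> {}" using eq tc by (auto simp: columns_iff)
  then obtain d v' where v: "v = d # v'" using tv by (cases v) auto
  have "d \<in> columns n" using Cons.prems(3) v by simp
  moreover have "set c = set d" using eq(1) tc tv v by simp
  ultimately have "c = d" using c by (metis columns_iff column_of_set)
  moreover have "(concat w, concat v') \<in> plactic_cong n" using eq(2) tc tv v by simp
  then have "w = v'"
    using Cons.prems v by (intro Cons.IH) (auto simp: successively_Cons)
  ultimately show ?case using v by simp
qed

text \<open>An empty second column is not a generator and must be dropped; the word of columns then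
  becomes shorter.\<close>

definition straighten :: "nat list \<Rightarrow> nat list \<Rightarrow> nat list list" where
  "straighten \<alpha> \<beta> = column_of (insert_word \<alpha> (set \<beta>)) #
     (if bumped_word \<alpha> (set \<beta>) = [] then [] else [bumped_word \<alpha> (set \<beta>)])"

lemma
  assumes ab: "\<alpha> \<in> columns n" "\<beta> \<in> columns n" and nt: "\<not> tableau_pair \<alpha> \<beta>"
  shows straighten_columns: "straighten \<alpha> \<beta> \<in> lists (columns n)"
    and straighten_cong: "(\<alpha> @ \<beta>, concat (straighten \<alpha> \<beta>)) \<in> plactic_cong n"
    and length_straighten: "length (hd (straighten \<alpha> \<beta>)) > length \<alpha>"
proof -
  let ?S = "insert_word \<alpha> (set \<beta>)" and ?d = "bumped_word \<alpha> (set \<beta>)"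
  have A: "set \<alpha> \<union> set \<beta> \<subseteq> plactic_alphabet n" and srt: "sorted_wrt (>) \<alpha>" "sorted_wrt (>) \<beta>"
    and ne: "\<alpha> \<noteq> []"
    using ab by (auto simp: columns_iff)
  have SA: "?S \<subseteq> plactic_alphabet n" and dA: "set ?d \<subseteq> plactic_alphabet n"
    using A insert_word_subset[of \<alpha> "set \<beta>"] set_bumped_word_subset[of \<alpha> "set \<beta>"] by blast+
  then have fin: "finite ?S" using finite_plactic_alphabet finite_subset by blast
  have sup: "set \<alpha> \<subseteq> ?S" by (rule insert_word_supset[OF srt(1)])
  have d: "sorted_wrt (>) ?d" using sorted_bumped_word[OF srt(1)] by blast
  have "column_of ?S \<noteq> []" using sup ne set_column_of[OF fin] by force
  then have "column_of ?S \<in> columns n"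
    using SA set_column_of[OF fin] sorted_column_of[OF fin] by (simp add: columns_iff)
  then show "straighten \<alpha> \<beta> \<in> lists (columns n)"
    using d dA by (auto simp: straighten_def columns_iff)
  show cong: "(\<alpha> @ \<beta>, concat (straighten \<alpha> \<beta>)) \<in> plactic_cong n"
    using plactic_cong_insert_word_bumped_word[of "set \<beta>" n \<alpha>] A column_of_set[OF srt(2)]
    by (auto simp: straighten_def)
  \<comment> \<open>The new column contains \<alpha>. If it were no larger, preservation of content
    would leave the letters of \<beta> for the bumped word; both are decreasing, hence equal, and
    the pair would be a tableau.\<close>
  have "?S \<noteq> set \<alpha>"
  proof
    assume eq: "?S = set \<alpha>"
    then have "mset ?d = mset \<beta>"
      using plactic_cong_mset[OF cong] column_of_set[OF srt(1)]
      by (auto simp: straighten_def split: if_splits)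
    then have "set ?d = set \<beta>" by (rule mset_eq_setD)
    then have "?d = \<beta>" using d srt(2) column_of_set by metis
    then show False using nt eq by (simp add: tableau_pair_def)
  qed
  then have "card (set \<alpha>) < card ?S" using sup fin by (intro psubset_card_mono) auto
  moreover have "card (set \<alpha>) = length \<alpha>"
    using length_column_of[of "set \<alpha>"] column_of_set[OF srt(1)] by simp
  ultimately show "length (hd (straighten \<alpha> \<beta>)) > length \<alpha>"
    using length_column_of[OF fin] by (simp add: straighten_def)
qed

lemma not_tableauE:
  assumes "w \<in> lists (columns n)" "\<not> tableau w"
  obtains p \<alpha> \<beta> q where "w = p @ [\<alpha>, \<beta>] @ q" "\<not> tableau_pair \<alpha> \<beta>"
    "p \<in> lists (columns n)" "q \<in> lists (columns n)" "\<alpha> \<in> columns n" "\<beta> \<in> columns n"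
proof -
  have "\<exists>p \<alpha> \<beta> q. w = p @ [\<alpha>, \<beta>] @ q \<and> \<not> tableau_pair \<alpha> \<beta>"
    using assms(2)
  proof (induction w)
    case (Cons a w)
    then obtain b w' where w: "w = b # w'" by (cases w) auto
    show ?case
    proof (cases "tableau_pair a b")
      case True
      then obtain p \<alpha> \<beta> q where "w = p @ [\<alpha>, \<beta>] @ q \<and> \<not> tableau_pair \<alpha> \<beta>"
        using Cons w by auto
      then have "a # w = (a # p) @ [\<alpha>, \<beta>] @ q \<and> \<not> tableau_pair \<alpha> \<beta>" by simp
      then show ?thesis by blast
    next
      case False
      then have "a # w = [] @ [a, b] @ w' \<and> \<not> tableau_pair a b" using w by simp
      then show ?thesis by blast
    qed
  qed simp
  then obtain p \<alpha> \<beta> q where "w = p @ [\<alpha>, \<beta>] @ q" "\<not> tableau_pair \<alpha> \<beta>" by blast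
  then show ?thesis using assms(1) by (intro that[of p \<alpha> \<beta> q]) auto
qed

lemma straighten_step:
  assumes "\<alpha> \<in> columns n" "\<beta> \<in> columns n" "\<not> tableau_pair \<alpha> \<beta>"
    and "p \<in> lists (columns n)" "q \<in> lists (columns n)"
  shows "(concat (p @ [\<alpha>, \<beta>] @ q), concat (p @ straighten \<alpha> \<beta> @ q)) \<in> plactic_cong n"
  using presented_cong.append[OF straighten_cong[OF assms(1-3)] concat_columns[OF assms(4)]
    concat_columns[OF assms(5)]] by simp

section \<open>Termination, normal forms and minimality\<close>

context
  fixes n r
  assumes ord: "column_order n r"
begin

lemma column_order_irrefl: "irrefl r"
  and column_order_trans: "trans r"
  using ord by (auto simp: column_order_def strict_linear_order_on_def)

lemma wf_lenlex_column_order: "wf (lenlex r)"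
proof -
  have "finite r"
    using ord finite_columns by (auto simp: column_order_def intro: finite_subset)
  then have "wf r"
    using column_order_irrefl column_order_trans
    by (intro finite_acyclic_wf) (auto simp: acyclic_def irrefl_def trancl_id)
  then show ?thesis by blast
qed

lemma lenlex_column_order_total:
  "u \<in> lists (columns n) \<Longrightarrow> v \<in> lists (columns n) \<Longrightarrow> u \<noteq> v \<Longrightarrow>
    (u, v) \<in> lenlex r \<or> (v, u) \<in> lenlex r"
proof (induction u arbitrary: v)
  case Nil
  then show ?case by auto
next
  case (Cons a u)
  have "total_on (columns n) r"
    using ord by (auto simp: column_order_def strict_linear_order_on_def)
  then show ?case using Cons
    by (cases v) (auto simp: Cons_lenlex_iff total_on_def)
qed

text \<open>Either the word loses a letter, or the comparison is decided at the first column of the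
  pair, where the new one is longer and hence smaller in r.\<close>

lemma straighten_lenlex:
  assumes "\<alpha> \<in> columns n" "\<beta> \<in> columns n" "\<not> tableau_pair \<alpha> \<beta>"
  shows "(p @ straighten \<alpha> \<beta> @ q, p @ [\<alpha>, \<beta>] @ q) \<in> lenlex r"
proof -
  define \<gamma> \<delta> where "\<gamma> = column_of (insert_word \<alpha> (set \<beta>))" and "\<delta> = bumped_word \<alpha> (set \<beta>)"
  then have s: "straighten \<alpha> \<beta> = [\<gamma>] \<or> straighten \<alpha> \<beta> = [\<gamma>, \<delta>]"
    by (simp add: straighten_def)
  then have "\<gamma> \<in> columns n" "length \<gamma> > length \<alpha>"
    using straighten_columns[OF assms] length_straighten[OF assms] by auto
  then have "(\<gamma>, \<alpha>) \<in> r" using ord assms(1) by (simp add: column_order_def)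
  then show ?thesis using s column_order_irrefl by (auto simp: Cons_lenlex_iff)
qed

text \<open>The bound on t is kept because it turns uniqueness of the tableau into minimality in the
  class.\<close>

lemma ex_tableau:
  assumes "w \<in> lists (columns n)"
  shows "\<exists>t\<in>lists (columns n). tableau t \<and> (concat w, concat t) \<in> plactic_cong n \<and> (t, w) \<in> (lenlex r)\<^sup>="
  using wf_lenlex_column_order assms
proof (induction w rule: wf_induct_rule)
  case (less w)
  show ?case
  proof (cases "tableau w")
    case True
    then show ?thesis
      using less.prems presented_cong.refl[OF concat_columns[OF less.prems]] by blast
  next
    case False
    then obtain p \<alpha> \<beta> q where w: "w = p @ [\<alpha>, \<beta>] @ q" "\<not> tableau_pair \<alpha> \<beta>"
      "p \<in> lists (columns n)" "q \<in> lists (columns n)" "\<alpha> \<in> columns n" "\<beta> \<in> columns n"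
      using not_tableauE[OF less.prems] by blast
    define w' where "w' = p @ straighten \<alpha> \<beta> @ q"
    have w': "w' \<in> lists (columns n)" "(w', w) \<in> lenlex r" "(concat w, concat w') \<in> plactic_cong n"
      using straighten_columns[OF w(5,6,2)] straighten_lenlex[OF w(5,6,2)]
        straighten_step[OF w(5,6,2)] w by (auto simp: w'_def)
    obtain t where t: "t \<in> lists (columns n)" "tableau t" "(concat w', concat t) \<in> plactic_cong n"
      "(t, w') \<in> (lenlex r)\<^sup>="
      using less.IH[OF w'(2,1)] by blast
    have "(t, w) \<in> lenlex r"
      using t(4) w'(2) lenlex_trans[OF _ _ column_order_trans] by blast
    then show ?thesis using t(1,2) presented_cong.trans[OF w'(3) t(3)] by blast
  qed
qed

text \<open>A smaller congruent v would straighten to a tableau not above v, hence below w; but by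
  uniqueness that tableau is w.\<close>

lemma tableau_minimal:
  assumes "w \<in> lists (columns n)" "tableau w" "v \<in> lists (columns n)"
    and "(concat v, concat w) \<in> plactic_cong n"
  shows "(v, w) \<notin> lenlex r"
proof
  assume vw: "(v, w) \<in> lenlex r"
  obtain t where t: "t \<in> lists (columns n)" "tableau t" "(concat v, concat t) \<in> plactic_cong n"
    "(t, v) \<in> (lenlex r)\<^sup>="
    using ex_tableau[OF assms(3)] by blast
  then have "t = w"
    using tableau_unique[OF t(1,2) assms(1,2)] assms(4)
    by (blast intro: presented_cong.sym presented_cong.trans)
  then show False using t(4) vw wf_lenlex_column_order by (auto dest: wf_not_sym wf_not_refl)
qed

end

subsection \<open>Ideals of monoid algebras\<close>

text \<open>Elements of a monoid algebra are handled as functionals: the convolution product is determined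
  by \<open>\<langle>f g, \<phi>\<rangle> = \<langle>f, \<lambda>a. \<langle>g, \<lambda>b. \<phi> (a b)\<rangle>\<rangle>\<close>, which turns the ring axioms into the monoid axioms.\<close>

context ring
begin

definition pairing :: "('m \<Rightarrow> 'a) \<Rightarrow> ('m \<Rightarrow> 'a) \<Rightarrow> 'a" where
  "pairing f \<phi> = (\<Oplus>x\<in>{x. f x \<noteq> \<zero>}. f x \<otimes> \<phi> x)"

definition single :: "'a \<Rightarrow> 'm \<Rightarrow> 'm \<Rightarrow> 'a" where
  "single k u = (\<lambda>x. if x = u then k else \<zero>)"

text \<open>The support is not tied to a monoid here, so the linear facts serve both the source and
  the target of \<open>monoid_algebra_map\<close>.\<close>

definition finsupp :: "('m \<Rightarrow> 'a) set" where
  "finsupp = {f. range f \<subseteq> carrier R \<and> finite {x. f x \<noteq> \<zero>}}"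

lemma finsuppD:
  assumes "f \<in> finsupp"
  shows "f x \<in> carrier R" "finite {x. f x \<noteq> \<zero>}"
  using assms by (auto simp: finsupp_def)

lemma pairing_superset:
  assumes "f \<in> finsupp" "finite A" "{x. f x \<noteq> \<zero>} \<subseteq> A" "\<And>x. x \<in> A \<Longrightarrow> \<phi> x \<in> carrier R"
  shows "pairing f \<phi> = (\<Oplus>x\<in>A. f x \<otimes> \<phi> x)"
  unfolding pairing_def
  using assms by (intro add.finprod_mono_neutral_cong_left) (auto simp: finsuppD)

lemma pairing_closed:
  assumes "f \<in> finsupp" "\<And>x. f x \<noteq> \<zero> \<Longrightarrow> \<phi> x \<in> carrier R"
  shows "pairing f \<phi> \<in> carrier R"
  unfolding pairing_def using assms by (intro finsum_closed) (auto simp: finsuppD)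

lemma pairing_cong:
  assumes "f \<in> finsupp" "\<And>x. f x \<noteq> \<zero> \<Longrightarrow> \<phi> x = \<psi> x" "\<And>x. f x \<noteq> \<zero> \<Longrightarrow> \<psi> x \<in> carrier R"
  shows "pairing f \<phi> = pairing f \<psi>"
  unfolding pairing_def using assms by (intro finsum_cong') (auto simp: finsuppD)

lemma pairing_zero_left: "pairing (\<lambda>x. \<zero>) \<phi> = \<zero>"
  by (simp add: pairing_def)

lemma pairing_zero_right: "f \<in> finsupp \<Longrightarrow> pairing f (\<lambda>x. \<zero>) = \<zero>"
  unfolding pairing_def by (intro add.finprod_one_eqI) (auto simp: finsuppD)

text \<open>Evaluation at y is itself a pairing, so identities between pairings give pointwise
  equality of elements.\<close>

lemma pairing_single_right:
  assumes "f \<in> finsupp"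
  shows "pairing f (single \<one> y) = f y"
proof -
  have "pairing f (single \<one> y) = (\<Oplus>x\<in>insert y {x. f x \<noteq> \<zero>}. f x \<otimes> single \<one> y x)"
    using assms by (intro pairing_superset) (auto simp: finsuppD single_def)
  also have "\<dots> = (\<Oplus>x\<in>insert y {x. f x \<noteq> \<zero>}. if x = y then f x else \<zero>)"
    using assms by (intro finsum_cong') (auto simp: finsuppD single_def)
  also have "\<dots> = f y"
    using assms by (intro add.finprod_singleton_swap) (auto simp: finsuppD)
  finally show ?thesis .
qed

lemma single_finsupp: "k \<in> carrier R \<Longrightarrow> single k u \<in> finsupp"
  by (auto simp: finsupp_def single_def)

lemma pairing_single_left:
  assumes "k \<in> carrier R" "\<phi> u \<in> carrier R"
  shows "pairing (single k u) \<phi> = k \<otimes> \<phi> u"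
proof -
  have "pairing (single k u) \<phi> = (\<Oplus>x\<in>{u}. single k u x \<otimes> \<phi> x)"
    using assms by (intro pairing_superset single_finsupp) (auto simp: single_def)
  then show ?thesis using assms by (simp add: single_def)
qed

lemma finsupp_add:
  assumes "f \<in> finsupp" "g \<in> finsupp"
  shows "(\<lambda>x. f x \<oplus> g x) \<in> finsupp"
proof -
  have "{x. f x \<oplus> g x \<noteq> \<zero>} \<subseteq> {x. f x \<noteq> \<zero>} \<union> {x. g x \<noteq> \<zero>}" by auto
  then have "finite {x. f x \<oplus> g x \<noteq> \<zero>}" by (rule finite_subset) (use assms in \<open>simp add: finsuppD\<close>)
  moreover have "f x \<oplus> g x \<in> carrier R" for x using assms by (simp add: finsuppD)
  ultimately show ?thesis by (auto simp: finsupp_def)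
qed

lemma pairing_add_left:
  assumes "f \<in> finsupp" "g \<in> finsupp"
    and "\<And>x. f x \<noteq> \<zero> \<or> g x \<noteq> \<zero> \<Longrightarrow> \<phi> x \<in> carrier R"
  shows "pairing (\<lambda>x. f x \<oplus> g x) \<phi> = pairing f \<phi> \<oplus> pairing g \<phi>"
proof -
  let ?A = "{x. f x \<noteq> \<zero>} \<union> {x. g x \<noteq> \<zero>}"
  have fin: "finite ?A" using assms by (simp add: finsuppD)
  have "pairing (\<lambda>x. f x \<oplus> g x) \<phi> = (\<Oplus>x\<in>?A. (f x \<oplus> g x) \<otimes> \<phi> x)"
    using assms fin by (intro pairing_superset finsupp_add) auto
  also have "\<dots> = (\<Oplus>x\<in>?A. f x \<otimes> \<phi> x \<oplus> g x \<otimes> \<phi> x)"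
    using assms by (intro finsum_cong') (auto simp: finsuppD l_distr)
  also have "\<dots> = (\<Oplus>x\<in>?A. f x \<otimes> \<phi> x) \<oplus> (\<Oplus>x\<in>?A. g x \<otimes> \<phi> x)"
    using assms by (intro finsum_addf) (auto simp: finsuppD)
  also have "\<dots> = pairing f \<phi> \<oplus> pairing g \<phi>"
    using assms fin by (subst (1 2) pairing_superset[of _ ?A]) auto
  finally show ?thesis .
qed

lemma pairing_add_right:
  assumes "f \<in> finsupp" "\<And>x. f x \<noteq> \<zero> \<Longrightarrow> \<phi> x \<in> carrier R" "\<And>x. f x \<noteq> \<zero> \<Longrightarrow> \<psi> x \<in> carrier R"
  shows "pairing f (\<lambda>x. \<phi> x \<oplus> \<psi> x) = pairing f \<phi> \<oplus> pairing f \<psi>"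
proof -
  have "pairing f (\<lambda>x. \<phi> x \<oplus> \<psi> x) = (\<Oplus>x\<in>{x. f x \<noteq> \<zero>}. f x \<otimes> \<phi> x \<oplus> f x \<otimes> \<psi> x)"
    unfolding pairing_def using assms by (intro finsum_cong') (auto simp: finsuppD r_distr)
  also have "\<dots> = pairing f \<phi> \<oplus> pairing f \<psi>"
    unfolding pairing_def using assms by (intro finsum_addf) (auto simp: finsuppD)
  finally show ?thesis .
qed

lemma finsum_fibres:
  assumes "finite A" "\<And>x. x \<in> A \<Longrightarrow> F x \<in> carrier R"
  shows "(\<Oplus>x\<in>A. F x) = (\<Oplus>y\<in>q ` A. \<Oplus>x\<in>{x\<in>A. q x = y}. F x)"
proof -
  have "A = (\<Union>y\<in>q ` A. {x\<in>A. q x = y})" by auto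
  then have "(\<Oplus>x\<in>A. F x) = (\<Oplus>x\<in>(\<Union>y\<in>q ` A. {x\<in>A. q x = y}). F x)" by simp
  also have "\<dots> = (\<Oplus>y\<in>q ` A. \<Oplus>x\<in>{x\<in>A. q x = y}. F x)"
    using assms by (intro add.finprod_UN_disjoint) (auto simp: pairwise_def disjnt_def)
  finally show ?thesis .
qed

lemma finsum_Times:
  assumes "finite A" "finite B" "\<And>x y. x \<in> A \<Longrightarrow> y \<in> B \<Longrightarrow> F x y \<in> carrier R"
  shows "(\<Oplus>p\<in>A \<times> B. F (fst p) (snd p)) = (\<Oplus>x\<in>A. \<Oplus>y\<in>B. F x y)"
proof (cases "B = {}")
  case False
  have "(\<Oplus>p\<in>A \<times> B. F (fst p) (snd p))
      = (\<Oplus>x\<in>fst ` (A \<times> B). \<Oplus>p\<in>{p\<in>A \<times> B. fst p = x}. F (fst p) (snd p))"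
    using assms by (intro finsum_fibres) auto
  also have "\<dots> = (\<Oplus>x\<in>A. \<Oplus>y\<in>B. F x y)"
  proof (rule finsum_cong')
    show "fst ` (A \<times> B) = A" using False by auto
    show "(\<lambda>x. \<Oplus>y\<in>B. F x y) \<in> A \<rightarrow> carrier R" using assms by auto
    fix x assume x: "x \<in> A"
    have "{p\<in>A \<times> B. fst p = x} = Pair x ` B" using x by auto
    then have "(\<Oplus>p\<in>{p\<in>A \<times> B. fst p = x}. F (fst p) (snd p)) = (\<Oplus>p\<in>Pair x ` B. F (fst p) (snd p))"
      by simp
    also have "\<dots> = (\<Oplus>y\<in>B. F x y)"
      using assms x by (subst finsum_reindex) (auto simp: inj_on_def)
    finally show "(\<Oplus>p\<in>{p\<in>A \<times> B. fst p = x}. F (fst p) (snd p)) = (\<Oplus>y\<in>B. F x y)" .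
  qed
  finally show ?thesis .
qed (use finsum_zero in simp)

text \<open>Change of variables for the push-forward of a finite family along q. Convolution (q
  multiplies pairs) and the linear extension of h (q = h) are both instances.\<close>

lemma
  assumes "finite A" "\<And>x. x \<in> A \<Longrightarrow> F x \<in> carrier R"
  shows push_finsupp: "(\<lambda>y. \<Oplus>x\<in>{x\<in>A. q x = y}. F x) \<in> finsupp" (is ?fs)
    and push_support: "{y. (\<Oplus>x\<in>{x\<in>A. q x = y}. F x) \<noteq> \<zero>} \<subseteq> q ` A" (is ?sup)
    and pairing_push: "(\<And>x. x \<in> A \<Longrightarrow> \<phi> (q x) \<in> carrier R) \<Longrightarrow>
      pairing (\<lambda>y. \<Oplus>x\<in>{x\<in>A. q x = y}. F x) \<phi> = (\<Oplus>x\<in>A. F x \<otimes> \<phi> (q x))"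
proof -
  show sup: ?sup
  proof
    fix y assume y: "y \<in> {y. (\<Oplus>x\<in>{x\<in>A. q x = y}. F x) \<noteq> \<zero>}"
    show "y \<in> q ` A"
    proof (rule ccontr)
      assume "y \<notin> q ` A"
      then have empty: "{x\<in>A. q x = y} = {}" by auto
      show False using y by (simp add: empty)
    qed
  qed
  show fs: ?fs
    using assms sup by (auto simp: finsupp_def intro!: finsum_closed elim: finite_subset)
  assume \<phi>: "\<And>x. x \<in> A \<Longrightarrow> \<phi> (q x) \<in> carrier R"
  have "pairing (\<lambda>y. \<Oplus>x\<in>{x\<in>A. q x = y}. F x) \<phi>
      = (\<Oplus>y\<in>q ` A. (\<Oplus>x\<in>{x\<in>A. q x = y}. F x) \<otimes> \<phi> y)"
    using assms fs sup \<phi> by (intro pairing_superset) auto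
  also have "\<dots> = (\<Oplus>y\<in>q ` A. \<Oplus>x\<in>{x\<in>A. q x = y}. F x \<otimes> \<phi> (q x))"
  proof (rule finsum_cong'[OF HOL.refl])
    show "(\<lambda>y. \<Oplus>x\<in>{x\<in>A. q x = y}. F x \<otimes> \<phi> (q x)) \<in> q ` A \<rightarrow> carrier R"
      using assms \<phi> by (auto intro!: finsum_closed)
    fix y assume y: "y \<in> q ` A"
    have "(\<Oplus>x\<in>{x\<in>A. q x = y}. F x) \<otimes> \<phi> y = (\<Oplus>x\<in>{x\<in>A. q x = y}. F x \<otimes> \<phi> y)"
      using assms \<phi> y by (intro finsum_ldistr) auto
    also have "\<dots> = (\<Oplus>x\<in>{x\<in>A. q x = y}. F x \<otimes> \<phi> (q x))"
      using assms \<phi> by (intro finsum_cong') auto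
    finally show "(\<Oplus>x\<in>{x\<in>A. q x = y}. F x) \<otimes> \<phi> y = (\<Oplus>x\<in>{x\<in>A. q x = y}. F x \<otimes> \<phi> (q x))" .
  qed
  also have "\<dots> = (\<Oplus>x\<in>A. F x \<otimes> \<phi> (q x))"
    using assms \<phi> by (intro finsum_fibres[symmetric]) auto
  finally show "pairing (\<lambda>y. \<Oplus>x\<in>{x\<in>A. q x = y}. F x) \<phi> = (\<Oplus>x\<in>A. F x \<otimes> \<phi> (q x))" .
qed

lemma monoid_algebra_map_alt:
  "monoid_algebra_map R h f = (\<lambda>y. \<Oplus>x\<in>{x\<in>{x. f x \<noteq> \<zero>}. h x = y}. f x)"
  by (simp add: monoid_algebra_map_def)

lemma
  assumes "f \<in> finsupp"
  shows monoid_algebra_map_finsupp: "monoid_algebra_map R h f \<in> finsupp"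
    and pairing_monoid_algebra_map:
      "(\<And>x. f x \<noteq> \<zero> \<Longrightarrow> \<phi> (h x) \<in> carrier R) \<Longrightarrow>
        pairing (monoid_algebra_map R h f) \<phi> = pairing f (\<lambda>x. \<phi> (h x))"
  unfolding monoid_algebra_map_alt pairing_def[of f]
  by (rule push_finsupp pairing_push; use assms in \<open>simp add: finsuppD\<close>)+

lemma monoid_algebra_map_apply:
  assumes "f \<in> finsupp"
  shows "monoid_algebra_map R h f y = pairing f (\<lambda>x. single \<one> y (h x))"
  using pairing_single_right[OF monoid_algebra_map_finsupp[OF assms], of h y]
    pairing_monoid_algebra_map[OF assms, of "single \<one> y" h] by (simp add: single_def)

lemma monoid_algebra_map_add:
  assumes "f \<in> finsupp" "g \<in> finsupp"
  shows "monoid_algebra_map R h (\<lambda>x. f x \<oplus> g x) y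
    = monoid_algebra_map R h f y \<oplus> monoid_algebra_map R h g y"
proof -
  have "single \<one> y (h x) \<in> carrier R" for x by (simp add: single_def)
  then show ?thesis
    using assms by (simp add: monoid_algebra_map_apply finsupp_add pairing_add_left)
qed

end

section \<open>The ring structure of the monoid algebra\<close>

locale monoid_ring = ring R + M: monoid M for R (structure) and M (structure)
begin

abbreviation A where "A \<equiv> monoid_algebra R M"

lemma carrier_A: "carrier A = {f \<in> finsupp. {x. f x \<noteq> \<zero>} \<subseteq> carrier M}"
  by (auto simp: monoid_algebra_def finsupp_def)

lemma A_finsupp: "f \<in> carrier A \<Longrightarrow> f \<in> finsupp"
  by (simp add: carrier_A)

lemma A_support: "f \<in> carrier A \<Longrightarrow> f x \<noteq> \<zero> \<Longrightarrow> x \<in> carrier M"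
  by (auto simp: carrier_A)

lemma add_A: "f \<oplus>\<^bsub>A\<^esub> g = (\<lambda>x. f x \<oplus> g x)"
  and zero_A: "\<zero>\<^bsub>A\<^esub> = (\<lambda>x. \<zero>)"
  and one_A: "\<one>\<^bsub>A\<^esub> = single \<one> \<one>\<^bsub>M\<^esub>"
  by (simp_all add: monoid_algebra_def single_def)

lemma mult_A_alt:
  "f \<otimes>\<^bsub>A\<^esub> g = (\<lambda>x. \<Oplus>p\<in>{p\<in>{x. f x \<noteq> \<zero>} \<times> {x. g x \<noteq> \<zero>}. fst p \<otimes>\<^bsub>M\<^esub> snd p = x}. f (fst p) \<otimes> g (snd p))"
proof -
  have "{(a, b). f a \<noteq> \<zero> \<and> g b \<noteq> \<zero> \<and> a \<otimes>\<^bsub>M\<^esub> b = x}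
     = {p\<in>{x. f x \<noteq> \<zero>} \<times> {x. g x \<noteq> \<zero>}. fst p \<otimes>\<^bsub>M\<^esub> snd p = x}" for x
    by auto
  then show ?thesis by (simp add: monoid_algebra_def)
qed

lemma
  assumes "f \<in> carrier A" "g \<in> carrier A"
  shows mult_A_closed: "f \<otimes>\<^bsub>A\<^esub> g \<in> carrier A"
    and pairing_mult: "(\<And>x. x \<in> carrier M \<Longrightarrow> \<phi> x \<in> carrier R) \<Longrightarrow>
      pairing (f \<otimes>\<^bsub>A\<^esub> g) \<phi> = pairing f (\<lambda>a. pairing g (\<lambda>b. \<phi> (a \<otimes>\<^bsub>M\<^esub> b)))"
proof -
  let ?P = "{x. f x \<noteq> \<zero>} \<times> {x. g x \<noteq> \<zero>}"
  have P: "finite ?P" "\<And>p. p \<in> ?P \<Longrightarrow> f (fst p) \<otimes> g (snd p) \<in> carrier R"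
    "\<And>p. p \<in> ?P \<Longrightarrow> fst p \<otimes>\<^bsub>M\<^esub> snd p \<in> carrier M"
    using assms A_support[OF assms(1)] A_support[OF assms(2)]
    by (auto simp: finsuppD A_finsupp)
  note fs = A_finsupp[OF assms(1)] A_finsupp[OF assms(2)]
  have "f \<otimes>\<^bsub>A\<^esub> g \<in> finsupp"
    unfolding mult_A_alt by (rule push_finsupp[OF P(1,2)])
  moreover have "{x. (f \<otimes>\<^bsub>A\<^esub> g) x \<noteq> \<zero>} \<subseteq> (\<lambda>p. fst p \<otimes>\<^bsub>M\<^esub> snd p) ` ?P"
    unfolding mult_A_alt by (rule push_support[OF P(1,2)])
  moreover have "(\<lambda>p. fst p \<otimes>\<^bsub>M\<^esub> snd p) ` ?P \<subseteq> carrier M" using P(3) by blast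
  ultimately show "f \<otimes>\<^bsub>A\<^esub> g \<in> carrier A"
    by (simp add: carrier_A)
  assume \<phi>: "\<And>x. x \<in> carrier M \<Longrightarrow> \<phi> x \<in> carrier R"
  have "pairing (f \<otimes>\<^bsub>A\<^esub> g) \<phi> = (\<Oplus>p\<in>?P. f (fst p) \<otimes> g (snd p) \<otimes> \<phi> (fst p \<otimes>\<^bsub>M\<^esub> snd p))"
    unfolding mult_A_alt using P \<phi> by (intro pairing_push) auto
  also have "\<dots> = (\<Oplus>a\<in>{x. f x \<noteq> \<zero>}. \<Oplus>b\<in>{x. g x \<noteq> \<zero>}. f a \<otimes> g b \<otimes> \<phi> (a \<otimes>\<^bsub>M\<^esub> b))"
    using assms fs \<phi> by (intro finsum_Times) (auto simp: finsuppD A_support)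
  also have "\<dots> = pairing f (\<lambda>a. pairing g (\<lambda>b. \<phi> (a \<otimes>\<^bsub>M\<^esub> b)))"
    unfolding pairing_def[of f]
  proof (rule finsum_cong'[OF HOL.refl])
    show "(\<lambda>a. f a \<otimes> pairing g (\<lambda>b. \<phi> (a \<otimes>\<^bsub>M\<^esub> b))) \<in> {x. f x \<noteq> \<zero>} \<rightarrow> carrier R"
      using assms fs \<phi> by (auto simp: finsuppD A_support intro!: pairing_closed)
    fix a assume a: "a \<in> {x. f x \<noteq> \<zero>}"
    have "(\<Oplus>b\<in>{x. g x \<noteq> \<zero>}. f a \<otimes> g b \<otimes> \<phi> (a \<otimes>\<^bsub>M\<^esub> b))
        = (\<Oplus>b\<in>{x. g x \<noteq> \<zero>}. f a \<otimes> (g b \<otimes> \<phi> (a \<otimes>\<^bsub>M\<^esub> b)))"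
      using assms fs \<phi> a by (intro finsum_cong') (auto simp: finsuppD A_support m_assoc)
    also have "\<dots> = f a \<otimes> pairing g (\<lambda>b. \<phi> (a \<otimes>\<^bsub>M\<^esub> b))"
      unfolding pairing_def using assms fs \<phi> a
      by (intro finsum_rdistr[symmetric]) (auto simp: finsuppD A_support)
    finally show "(\<Oplus>b\<in>{x. g x \<noteq> \<zero>}. f a \<otimes> g b \<otimes> \<phi> (a \<otimes>\<^bsub>M\<^esub> b))
        = f a \<otimes> pairing g (\<lambda>b. \<phi> (a \<otimes>\<^bsub>M\<^esub> b))" .
  qed
  finally show "pairing (f \<otimes>\<^bsub>A\<^esub> g) \<phi> = pairing f (\<lambda>a. pairing g (\<lambda>b. \<phi> (a \<otimes>\<^bsub>M\<^esub> b)))" .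
qed

lemma single_one_carrier [simp]: "single \<one> y x \<in> carrier R"
  by (simp add: single_def)

lemma mult_A_apply:
  assumes "f \<in> carrier A" "g \<in> carrier A"
  shows "(f \<otimes>\<^bsub>A\<^esub> g) x = pairing f (\<lambda>a. pairing g (\<lambda>b. single \<one> x (a \<otimes>\<^bsub>M\<^esub> b)))"
  using pairing_single_right[OF A_finsupp[OF mult_A_closed[OF assms]]]
    pairing_mult[OF assms, of "single \<one> x"] by simp

lemma single_closed: "k \<in> carrier R \<Longrightarrow> u \<in> carrier M \<Longrightarrow> single k u \<in> carrier A"
  using single_finsupp[of k u] by (auto simp: carrier_A) (auto simp: single_def split: if_splits)

lemma add_A_closed:
  assumes "f \<in> carrier A" "g \<in> carrier A"
  shows "f \<oplus>\<^bsub>A\<^esub> g \<in> carrier A"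
proof -
  have "x \<in> carrier M" if "f x \<oplus> g x \<noteq> \<zero>" for x
    using that A_support[OF assms(1), of x] A_support[OF assms(2), of x]
      finsuppD(1)[OF A_finsupp[OF assms(2)], of x]
    by (cases "f x = \<zero>") auto
  then show ?thesis
    using finsupp_add[OF assms[THEN A_finsupp]] by (auto simp: carrier_A add_A)
qed

lemma mult_A_assoc:
  assumes "f \<in> carrier A" "g \<in> carrier A" "h \<in> carrier A"
  shows "f \<otimes>\<^bsub>A\<^esub> g \<otimes>\<^bsub>A\<^esub> h = f \<otimes>\<^bsub>A\<^esub> (g \<otimes>\<^bsub>A\<^esub> h)"
proof
  fix x
  note fs = assms[THEN A_finsupp]
  have "(f \<otimes>\<^bsub>A\<^esub> g \<otimes>\<^bsub>A\<^esub> h) x = pairing f (\<lambda>a. pairing g (\<lambda>b. pairing h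
      (\<lambda>c. single \<one> x (a \<otimes>\<^bsub>M\<^esub> b \<otimes>\<^bsub>M\<^esub> c))))"
    using assms fs by (simp add: mult_A_apply mult_A_closed pairing_mult pairing_closed)
  also have "\<dots> = pairing f (\<lambda>a. pairing g (\<lambda>b. pairing h
      (\<lambda>c. single \<one> x (a \<otimes>\<^bsub>M\<^esub> (b \<otimes>\<^bsub>M\<^esub> c)))))"
    using assms fs by (intro pairing_cong) (auto simp: M.m_assoc A_support intro!: pairing_closed)
  also have "\<dots> = pairing f (\<lambda>a. pairing (g \<otimes>\<^bsub>A\<^esub> h) (\<lambda>u. single \<one> x (a \<otimes>\<^bsub>M\<^esub> u)))"
    using assms fs by (simp add: pairing_mult)
  also have "\<dots> = (f \<otimes>\<^bsub>A\<^esub> (g \<otimes>\<^bsub>A\<^esub> h)) x"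
    using assms fs by (simp add: mult_A_apply mult_A_closed)
  finally show "(f \<otimes>\<^bsub>A\<^esub> g \<otimes>\<^bsub>A\<^esub> h) x = (f \<otimes>\<^bsub>A\<^esub> (g \<otimes>\<^bsub>A\<^esub> h)) x" .
qed

lemma ring_A: "ring A"
proof (rule ringI)
  show "abelian_group A"
  proof (rule abelian_groupI)
    fix f assume f: "f \<in> carrier A"
    show "\<exists>g\<in>carrier A. g \<oplus>\<^bsub>A\<^esub> f = \<zero>\<^bsub>A\<^esub>"
    proof (rule bexI)
      have "{x. \<ominus> f x \<noteq> \<zero>} = {x. f x \<noteq> \<zero>}"
        using f by (auto simp: carrier_A finsuppD add.inv_eq_1_iff)
      then show "(\<lambda>x. \<ominus> f x) \<in> carrier A" using f by (auto simp: carrier_A finsupp_def)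
      show "(\<lambda>x. \<ominus> f x) \<oplus>\<^bsub>A\<^esub> f = \<zero>\<^bsub>A\<^esub>"
        using f by (auto simp: add_A zero_A carrier_A finsuppD l_neg)
    qed
  next
    show "\<zero>\<^bsub>A\<^esub> \<in> carrier A" by (auto simp: zero_A carrier_A finsupp_def)
  qed (auto simp: add_A_closed, auto simp: add_A zero_A carrier_A finsuppD a_ac)
  show "monoid A"
  proof (rule monoidI)
    show "\<one>\<^bsub>A\<^esub> \<in> carrier A" by (simp add: one_A single_closed)
    fix f assume f: "f \<in> carrier A"
    note fs = A_finsupp[OF f]
    show "\<one>\<^bsub>A\<^esub> \<otimes>\<^bsub>A\<^esub> f = f"
    proof
      fix x
      have "(\<one>\<^bsub>A\<^esub> \<otimes>\<^bsub>A\<^esub> f) x = pairing f (\<lambda>b. single \<one> x (\<one>\<^bsub>M\<^esub> \<otimes>\<^bsub>M\<^esub> b))"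
        using f fs by (simp add: one_A mult_A_apply single_closed pairing_single_left pairing_closed)
      also have "\<dots> = pairing f (single \<one> x)"
        using f fs by (intro pairing_cong) (auto simp: A_support)
      finally show "(\<one>\<^bsub>A\<^esub> \<otimes>\<^bsub>A\<^esub> f) x = f x" using fs by (simp add: pairing_single_right)
    qed
    show "f \<otimes>\<^bsub>A\<^esub> \<one>\<^bsub>A\<^esub> = f"
    proof
      fix x
      have "(f \<otimes>\<^bsub>A\<^esub> \<one>\<^bsub>A\<^esub>) x = pairing f (\<lambda>a. single \<one> x (a \<otimes>\<^bsub>M\<^esub> \<one>\<^bsub>M\<^esub>))"
        using f fs by (simp add: one_A mult_A_apply single_closed pairing_single_left)
      also have "\<dots> = pairing f (single \<one> x)"
        using f fs by (intro pairing_cong) (auto simp: A_support)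
      finally show "(f \<otimes>\<^bsub>A\<^esub> \<one>\<^bsub>A\<^esub>) x = f x" using fs by (simp add: pairing_single_right)
    qed
  qed (simp_all add: mult_A_closed mult_A_assoc)
next
  fix f g h assume c: "f \<in> carrier A" "g \<in> carrier A" "h \<in> carrier A"
  note fs = c[THEN A_finsupp]
  show "(f \<oplus>\<^bsub>A\<^esub> g) \<otimes>\<^bsub>A\<^esub> h = f \<otimes>\<^bsub>A\<^esub> h \<oplus>\<^bsub>A\<^esub> g \<otimes>\<^bsub>A\<^esub> h"
  proof
    fix x
    show "((f \<oplus>\<^bsub>A\<^esub> g) \<otimes>\<^bsub>A\<^esub> h) x = (f \<otimes>\<^bsub>A\<^esub> h \<oplus>\<^bsub>A\<^esub> g \<otimes>\<^bsub>A\<^esub> h) x"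
      using c fs add_A_closed[OF c(1,2)] unfolding add_A
      by (simp add: mult_A_apply pairing_add_left pairing_closed)
  qed
  show "h \<otimes>\<^bsub>A\<^esub> (f \<oplus>\<^bsub>A\<^esub> g) = h \<otimes>\<^bsub>A\<^esub> f \<oplus>\<^bsub>A\<^esub> h \<otimes>\<^bsub>A\<^esub> g"
  proof
    fix x
    show "(h \<otimes>\<^bsub>A\<^esub> (f \<oplus>\<^bsub>A\<^esub> g)) x = (h \<otimes>\<^bsub>A\<^esub> f \<oplus>\<^bsub>A\<^esub> h \<otimes>\<^bsub>A\<^esub> g) x"
      using c fs add_A_closed[OF c(1,2)] unfolding add_A
      by (simp add: mult_A_apply pairing_add_left pairing_add_right pairing_closed)
  qed
qed

section \<open>Kernels of linear extensions\<close>

lemma ideal_kernel: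
  fixes h :: "'c \<Rightarrow> 'e" and m :: "'e \<Rightarrow> 'e \<Rightarrow> 'e"
  assumes h: "\<And>u v. u \<in> carrier M \<Longrightarrow> v \<in> carrier M \<Longrightarrow> h (u \<otimes>\<^bsub>M\<^esub> v) = m (h u) (h v)"
  shows "ideal {f \<in> carrier A. monoid_algebra_map R h f = (\<lambda>x. \<zero>)} A"
proof -
  let ?I = "{f \<in> carrier A. monoid_algebra_map R h f = (\<lambda>x. \<zero>)}"
  interpret A: ring A by (rule ring_A)
  \<comment> \<open>By multiplicativity of h, the functions paired with either factor depend on
    words only through h, and a kernel element pairs to zero with every such function. This yields
    both absorption laws without a ring structure on the target.\<close>
  have mult: "monoid_algebra_map R h (f \<otimes>\<^bsub>A\<^esub> g) y
      = pairing f (\<lambda>a. pairing g (\<lambda>b. single \<one> y (m (h a) (h b))))"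
    if "f \<in> carrier A" "g \<in> carrier A" for f g y
  proof -
    have "monoid_algebra_map R h (f \<otimes>\<^bsub>A\<^esub> g) y
        = pairing f (\<lambda>a. pairing g (\<lambda>b. single \<one> y (h (a \<otimes>\<^bsub>M\<^esub> b))))"
      using that by (simp add: monoid_algebra_map_apply A_finsupp mult_A_closed pairing_mult)
    also have "\<dots> = pairing f (\<lambda>a. pairing g (\<lambda>b. single \<one> y (m (h a) (h b))))"
      using that by (intro pairing_cong) (auto simp: A_finsupp A_support h intro!: pairing_closed)
    finally show ?thesis .
  qed
  have l: "x \<otimes>\<^bsub>A\<^esub> a \<in> ?I" if "a \<in> ?I" "x \<in> carrier A" for a x
  proof -
    have a: "a \<in> carrier A" "monoid_algebra_map R h a = (\<lambda>x. \<zero>)" using that by auto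
    have "pairing a (\<lambda>b. single \<one> y (m (h c) (h b))) = \<zero>" for c y
      using pairing_monoid_algebra_map[OF A_finsupp[OF a(1)], of "\<lambda>b. single \<one> y (m (h c) b)" h] a(2)
      by (simp add: pairing_zero_left)
    then show ?thesis
      using mult[OF that(2) a(1)] that(2) a(1) by (auto simp: mult_A_closed pairing_zero_right A_finsupp)
  qed
  have r: "a \<otimes>\<^bsub>A\<^esub> x \<in> ?I" if "a \<in> ?I" "x \<in> carrier A" for a x
  proof -
    have a: "a \<in> carrier A" "monoid_algebra_map R h a = (\<lambda>x. \<zero>)" using that by auto
    have "pairing a (\<lambda>c. pairing x (\<lambda>b. single \<one> y (m (h c) (h b)))) = \<zero>" for y
      using pairing_monoid_algebra_map[OF A_finsupp[OF a(1)],
          of "\<lambda>c. pairing x (\<lambda>b. single \<one> y (m c (h b)))" h] a(2) that(2)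
      by (simp add: pairing_zero_left pairing_closed A_finsupp)
    then show ?thesis
      using mult[OF a(1) that(2)] that(2) a(1) by (auto simp: mult_A_closed)
  qed
  have add: "f \<oplus>\<^bsub>A\<^esub> g \<in> ?I" if "f \<in> ?I" "g \<in> ?I" for f g
  proof -
    have "monoid_algebra_map R h (f \<oplus>\<^bsub>A\<^esub> g) = (\<lambda>x. \<zero>)"
      unfolding add_A using that by (simp add: fun_eq_iff monoid_algebra_map_add A_finsupp)
    then show ?thesis using that by (auto simp: add_A_closed)
  qed
  show ?thesis
  proof (rule idealI[OF ring_A _ l r])
    show "subgroup ?I (add_monoid A)"
    proof (rule A.add.subgroupI)
      have "\<zero>\<^bsub>A\<^esub> \<in> ?I" using A.zero_closed by (auto simp: zero_A monoid_algebra_map_def)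
      then show "?I \<noteq> {}" by blast
      \<comment> \<open>Closure under negation comes from absorption, as multiplication by
        -1.\<close>
      fix a assume "a \<in> ?I"
      then show "\<ominus>\<^bsub>A\<^esub> a \<in> ?I" using l[of a "\<ominus>\<^bsub>A\<^esub> \<one>\<^bsub>A\<^esub>"] by (simp add: A.l_minus)
    qed (use add in auto)
  qed
qed

definition single_diff :: "'a \<Rightarrow> 'c \<Rightarrow> 'c \<Rightarrow> 'c \<Rightarrow> 'a" where
  "single_diff k u v = (\<lambda>x. single k u x \<oplus> single (\<ominus> k) v x)"

lemma single_diff_closed:
  "k \<in> carrier R \<Longrightarrow> u \<in> carrier M \<Longrightarrow> v \<in> carrier M \<Longrightarrow> single_diff k u v \<in> carrier A"
  using add_A_closed[of "single k u" "single (\<ominus> k) v"] by (simp add: single_diff_def add_A single_closed)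

lemma pairing_diff:
  assumes "k \<in> carrier R" "\<phi> u \<in> carrier R" "\<phi> v \<in> carrier R"
  shows "pairing (single_diff k u v) \<phi> = k \<otimes> \<phi> u \<ominus> k \<otimes> \<phi> v"
proof -
  have "pairing (single_diff k u v) \<phi> = pairing (single k u) \<phi> \<oplus> pairing (single (\<ominus> k) v) \<phi>"
    unfolding single_diff_def using assms
    by (intro pairing_add_left single_finsupp) (auto simp: single_def split: if_splits)
  then show ?thesis using assms by (simp add: pairing_single_left l_minus minus_eq)
qed

lemma single_diff_mult:
  assumes "k \<in> carrier R" "u \<in> carrier M" "v \<in> carrier M" "p \<in> carrier M" "q \<in> carrier M"
  shows "single k p \<otimes>\<^bsub>A\<^esub> single_diff \<one> u v \<otimes>\<^bsub>A\<^esub> single \<one> q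
     = single_diff k (p \<otimes>\<^bsub>M\<^esub> u \<otimes>\<^bsub>M\<^esub> q) (p \<otimes>\<^bsub>M\<^esub> v \<otimes>\<^bsub>M\<^esub> q)"
proof -
  have 1: "single k p \<otimes>\<^bsub>A\<^esub> single_diff \<one> u v = single_diff k (p \<otimes>\<^bsub>M\<^esub> u) (p \<otimes>\<^bsub>M\<^esub> v)"
  proof
    fix x
    have "(single k p \<otimes>\<^bsub>A\<^esub> single_diff \<one> u v) x
        = k \<otimes> (\<one> \<otimes> single \<one> x (p \<otimes>\<^bsub>M\<^esub> u) \<ominus> \<one> \<otimes> single \<one> x (p \<otimes>\<^bsub>M\<^esub> v))"
      using assms by (simp add: mult_A_apply single_closed single_diff_closed pairing_single_left pairing_diff)
    then show "(single k p \<otimes>\<^bsub>A\<^esub> single_diff \<one> u v) x = single_diff k (p \<otimes>\<^bsub>M\<^esub> u) (p \<otimes>\<^bsub>M\<^esub> v) x"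
      using assms by (auto simp: single_def single_diff_def minus_eq r_minus r_distr)
  qed
  show ?thesis unfolding 1
  proof
    fix x
    have "(single_diff k (p \<otimes>\<^bsub>M\<^esub> u) (p \<otimes>\<^bsub>M\<^esub> v) \<otimes>\<^bsub>A\<^esub> single \<one> q) x
        = k \<otimes> single \<one> x (p \<otimes>\<^bsub>M\<^esub> u \<otimes>\<^bsub>M\<^esub> q) \<ominus> k \<otimes> single \<one> x (p \<otimes>\<^bsub>M\<^esub> v \<otimes>\<^bsub>M\<^esub> q)"
      using assms by (simp add: mult_A_apply single_closed single_diff_closed pairing_single_left pairing_diff)
    then show "(single_diff k (p \<otimes>\<^bsub>M\<^esub> u) (p \<otimes>\<^bsub>M\<^esub> v) \<otimes>\<^bsub>A\<^esub> single \<one> q) x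
        = single_diff k (p \<otimes>\<^bsub>M\<^esub> u \<otimes>\<^bsub>M\<^esub> q) (p \<otimes>\<^bsub>M\<^esub> v \<otimes>\<^bsub>M\<^esub> q) x"
      using assms by (auto simp: single_def single_diff_def minus_eq)
  qed
qed

lemma monoid_algebra_map_diff:
  assumes "k \<in> carrier R" "u \<in> carrier M" "v \<in> carrier M" "h u = h v"
  shows "monoid_algebra_map R h (single_diff k u v) = (\<lambda>x. \<zero>)"
proof
  fix y
  show "monoid_algebra_map R h (single_diff k u v) y = \<zero>"
    using assms A_finsupp[OF single_diff_closed[OF assms(1-3)]]
    by (simp add: monoid_algebra_map_apply pairing_diff r_neg minus_eq)
qed

text \<open>A word alone in its fibre would pass its nonzero coefficient to the image
  uncancelled.\<close>

lemma kernel_support: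
  assumes "f \<in> carrier A" "monoid_algebra_map R h f = (\<lambda>x. \<zero>)" "f w \<noteq> \<zero>"
  obtains v where "f v \<noteq> \<zero>" "v \<noteq> w" "h v = h w"
proof (rule ccontr)
  assume "\<not> thesis"
  then have "{x. f x \<noteq> \<zero> \<and> h x = h w} = {w}" using that assms(3) by auto
  then have "monoid_algebra_map R h f (h w) = f w"
    using finsuppD(1)[OF A_finsupp[OF assms(1)]] by (simp add: monoid_algebra_map_def)
  then show False using assms by simp
qed

text \<open>The kernel is spanned by differences within fibres of h: subtracting f w times (w - v),
  for two support words of one fibre, removes w and adds no new word, so the support
  shrinks.\<close>

lemma kernel_subset:
  assumes J: "ideal J A" and sub: "\<And>k u v. k \<in> carrier R \<Longrightarrow> u \<in> carrier M \<Longrightarrow> v \<in> carrier M \<Longrightarrow>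
      h u = h v \<Longrightarrow> single_diff k u v \<in> J"
    and "f \<in> carrier A" "monoid_algebra_map R h f = (\<lambda>x. \<zero>)"
  shows "f \<in> J"
  using assms(3,4)
proof (induction "card {x. f x \<noteq> \<zero>}" arbitrary: f rule: less_induct)
  case less
  interpret J: ideal J A by fact
  note f = less.prems
  show ?case
  proof (cases "f = (\<lambda>x. \<zero>)")
    case True
    then show ?thesis using additive_subgroup.zero_closed[OF J.additive_subgroup_axioms] by (simp add: zero_A)
  next
    case False
    then obtain w where w: "f w \<noteq> \<zero>" by blast
    obtain v where v: "f v \<noteq> \<zero>" "v \<noteq> w" "h v = h w" using kernel_support[OF f w] by blast
    have M: "w \<in> carrier M" "v \<in> carrier M" using w v f A_support by auto
    have k: "f w \<in> carrier R" using f by (simp add: finsuppD A_finsupp)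
    define g where "g = f \<oplus>\<^bsub>A\<^esub> single_diff (\<ominus> f w) w v"
    have d: "single_diff (\<ominus> f w) w v \<in> carrier A" "monoid_algebra_map R h (single_diff (\<ominus> f w) w v) = (\<lambda>x. \<zero>)"
      "single_diff (f w) w v \<in> J"
      using k M v by (auto intro: single_diff_closed sub simp: monoid_algebra_map_diff)
    have g: "g \<in> carrier A" using f d by (simp add: g_def add_A_closed)
    have hg: "monoid_algebra_map R h g = (\<lambda>x. \<zero>)"
      unfolding g_def add_A using f d by (simp add: fun_eq_iff monoid_algebra_map_add A_finsupp)
    have gx: "g x = (if x = w then \<zero> else if x = v then f v \<oplus> f w else f x)" for x
      using v k finsuppD(1)[OF A_finsupp[OF f(1)]]
      by (auto simp: g_def add_A single_diff_def single_def r_neg)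
    have "{x. g x \<noteq> \<zero>} \<subset> {x. f x \<noteq> \<zero>}" using w v by (auto simp: gx split: if_splits)
    then have "card {x. g x \<noteq> \<zero>} < card {x. f x \<noteq> \<zero>}"
      using finsuppD(2)[OF A_finsupp[OF f(1)]] by (rule psubset_card_mono[rotated])
    then have "g \<in> J" using less.hyps g hg by blast
    then have "g \<oplus>\<^bsub>A\<^esub> single_diff (f w) w v \<in> J" using d(3) by (rule additive_subgroup.a_closed[OF J.additive_subgroup_axioms])
    moreover have "g \<oplus>\<^bsub>A\<^esub> single_diff (f w) w v = f"
    proof
      fix x
      show "(g \<oplus>\<^bsub>A\<^esub> single_diff (f w) w v) x = f x"
        using v k finsuppD(1)[OF A_finsupp[OF f(1)]]
        by (auto simp: add_A gx single_diff_def single_def a_assoc r_neg)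
    qed
    ultimately show ?thesis by simp
  qed
qed

lemma single_diff_zero: "u \<noteq> v \<Longrightarrow> k \<in> carrier R \<Longrightarrow> single_diff k u v = (\<lambda>x. \<zero>) \<Longrightarrow> k = \<zero>"
  by (auto simp: single_diff_def single_def dest!: fun_cong[of _ _ u])

lemma single_diff_trans_mem:
  assumes "ideal J A" "single_diff k u v \<in> J" "single_diff k v w \<in> J" "k \<in> carrier R"
  shows "single_diff k u w \<in> J"
proof -
  interpret J: ideal J A by fact
  have "single_diff k u v \<oplus>\<^bsub>A\<^esub> single_diff k v w = single_diff k u w"
    using assms(4) by (auto simp: add_A single_diff_def single_def fun_eq_iff a_ac r_neg l_neg)
  then show ?thesis using additive_subgroup.a_closed[OF J.additive_subgroup_axioms assms(2,3)] by simp
qed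

lemma single_diff_minus: "k \<in> carrier R \<Longrightarrow> single_diff (\<ominus> k) u v = single_diff k v u"
  by (auto simp: single_diff_def single_def fun_eq_iff a_comm)

lemma single_diff_refl: "k \<in> carrier R \<Longrightarrow> single_diff k u u = (\<lambda>x. \<zero>)"
  by (auto simp: single_diff_def single_def r_neg)

end

subsection \<open>The Groebner--Shirshov basis\<close>

lemma monoid_free_monoid: "monoid (free_monoid B)"
  by (rule monoidI) (auto simp: free_monoid_def)

lemma presented_cong_Image_eq_iff:
  assumes "a \<in> lists B"
  shows "presented_cong B R `` {a} = presented_cong B R `` {b} \<longleftrightarrow> (a, b) \<in> presented_cong B R"
proof
  assume "presented_cong B R `` {a} = presented_cong B R `` {b}"
  then have "(b, a) \<in> presented_cong B R" using presented_cong.refl[OF assms] by blast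
  then show "(a, b) \<in> presented_cong B R" by (rule presented_cong.sym)
next
  assume "(a, b) \<in> presented_cong B R"
  then show "presented_cong B R `` {a} = presented_cong B R `` {b}"
    by (blast intro: presented_cong.sym presented_cong.trans)
qed

text \<open>The product is a union over all representatives; compatibility of the congruence makes
  it a union of equal sets, and nonempty classes make it collapse.\<close>

lemma presented_monoid_mult:
  assumes "a \<in> lists B" "b \<in> lists B"
  shows "presented_cong B R `` {a} \<otimes>\<^bsub>presented_monoid B R\<^esub> presented_cong B R `` {b}
    = presented_cong B R `` {a @ b}"
proof -
  let ?cl = "\<lambda>u. presented_cong B R `` {u}"
  have eq: "?cl (u @ v) = ?cl (a @ b)" if "u \<in> ?cl a" "v \<in> ?cl b" for u v
  proof (rule presented_cong_Image_eq_iff[THEN iffD2, symmetric])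
    show "a @ b \<in> lists B" using assms by simp
    show "(a @ b, u @ v) \<in> presented_cong B R"
      using that by (intro presented_cong_append) auto
  qed
  have "a \<in> ?cl a" "b \<in> ?cl b" using assms by (auto intro: presented_cong.refl)
  then have "?cl a \<noteq> {}" "?cl b \<noteq> {}" by blast+
  moreover have "(\<Union>u\<in>?cl a. \<Union>v\<in>?cl b. ?cl (u @ v)) = (\<Union>u\<in>?cl a. \<Union>v\<in>?cl b. ?cl (a @ b))"
    by (intro SUP_cong HOL.refl eq)
  ultimately have "(\<Union>u\<in>?cl a. \<Union>v\<in>?cl b. ?cl (u @ v)) = ?cl (a @ b)"
    by (simp only: UN_constant if_False)
  then show ?thesis by (simp add: presented_monoid_def)
qed

lemma column_eval_append:
  assumes "u \<in> lists (columns n)" "v \<in> lists (columns n)"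
  shows "column_eval n (u @ v) = column_eval n u \<otimes>\<^bsub>plactic_monoid n\<^esub> column_eval n v"
  unfolding column_eval_def plactic_monoid_def
  using presented_monoid_mult[OF concat_columns[OF assms(1)] concat_columns[OF assms(2)]] by simp

lemma column_eval_eq_iff:
  "u \<in> lists (columns n) \<Longrightarrow>
    column_eval n u = column_eval n v \<longleftrightarrow> (concat u, concat v) \<in> plactic_cong n"
  unfolding column_eval_def by (rule presented_cong_Image_eq_iff[OF concat_columns])

lemma leading_word_eq:
  assumes "wf (lenlex r)" "f w \<noteq> \<zero>\<^bsub>K\<^esub>" "\<And>v. f v \<noteq> \<zero>\<^bsub>K\<^esub> \<Longrightarrow> v \<noteq> w \<Longrightarrow> (v, w) \<in> lenlex r"
  shows "leading_word K r f = w"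
  unfolding leading_word_def
proof (rule the_equality)
  fix v assume "f v \<noteq> \<zero>\<^bsub>K\<^esub> \<and> (\<forall>u. f u \<noteq> \<zero>\<^bsub>K\<^esub> \<longrightarrow> u \<noteq> v \<longrightarrow> (u, v) \<in> lenlex r)"
  then show "v = w" using assms wf_not_sym by metis
qed (use assms in blast)

lemma ex_greatest_word:
  assumes ord: "column_order n r" and "finite W" "W \<noteq> {}" "W \<subseteq> lists (columns n)"
  shows "\<exists>w\<in>W. \<forall>v\<in>W. v \<noteq> w \<longrightarrow> (v, w) \<in> lenlex r"
  using assms(2-4)
proof (induction rule: finite_ne_induct)
  case (insert u W)
  then obtain w where w: "w \<in> W" "\<forall>v\<in>W. v \<noteq> w \<longrightarrow> (v, w) \<in> lenlex r" by auto
  have "(u, w) \<in> lenlex r \<or> (w, u) \<in> lenlex r"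
    using insert.prems insert.hyps w by (intro lenlex_column_order_total[OF ord]) auto
  then show ?case
  proof
    assume "(w, u) \<in> lenlex r"
    then have "(v, u) \<in> lenlex r" if "v \<in> W" for v
      using w(2) that lenlex_trans[OF _ _ column_order_trans[OF ord], of v w u] by (cases "v = w") auto
    then show ?thesis by (intro bexI[of _ u]) auto
  qed (use w in blast)
qed simp

theorem theorem3p7:
  fixes K :: "('k, 'c) ring_scheme" and n :: nat and r :: "(nat list \<times> nat list) set"
  assumes "field K"
    and "n \<ge> 1"
    and "column_order n r"
  shows "\<exists>G. finite G \<and> groebner_shirshov_basis K n r G"
proof -
  note ord = assms(3)
  let ?C = "columns n" and ?h = "column_eval n" and ?F = "free_column_algebra K n"
  interpret K: field K by fact
  interpret monoid_ring K "free_monoid ?C"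
    by (intro monoid_ring.intro K.ring_axioms monoid_free_monoid)
  have F: "?F = monoid_algebra K (free_monoid ?C)" by (simp add: free_column_algebra_def)
  have free: "carrier (free_monoid ?C) = lists ?C" "u \<otimes>\<^bsub>free_monoid ?C\<^esub> v = u @ v" for u v
    by (simp_all add: free_monoid_def)
  interpret F: ring ?F unfolding F by (rule ring_A)
  have I: "plactic_ideal K n = {f \<in> carrier ?F. monoid_algebra_map K ?h f = (\<lambda>x. \<zero>\<^bsub>K\<^esub>)}"
    unfolding plactic_ideal_def a_kernel_def' by (simp add: plactic_algebra_def monoid_algebra_def)
  have ideal_I: "ideal (plactic_ideal K n) ?F"
    unfolding I F by (rule ideal_kernel) (simp add: free column_eval_append)
  define D where "D = {p \<in> ?C \<times> ?C. \<not> tableau_pair (fst p) (snd p)}"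
  define g where "g p = single_diff \<one>\<^bsub>K\<^esub> [fst p, snd p] (straighten (fst p) (snd p))" for p
  have gD: "g p \<in> plactic_ideal K n" "g p \<noteq> (\<lambda>x. \<zero>\<^bsub>K\<^esub>)" "leading_word K r (g p) = [fst p, snd p]"
    if pD: "p \<in> D" for p
  proof -
    obtain \<alpha> \<beta> where p: "p = (\<alpha>, \<beta>)" "\<alpha> \<in> ?C" "\<beta> \<in> ?C" "\<not> tableau_pair \<alpha> \<beta>"
      using pD by (cases p) (auto simp: D_def)
    note st = straighten_columns[OF p(2-4)] straighten_cong[OF p(2-4)]
      straighten_lenlex[OF ord p(2-4), of "[]" "[]"]
    have ne: "straighten \<alpha> \<beta> \<noteq> [\<alpha>, \<beta>]" by (metis length_straighten[OF p(2-4)] less_irrefl list.sel(1))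
    have "?h [\<alpha>, \<beta>] = ?h (straighten \<alpha> \<beta>)"
      using p st by (subst column_eval_eq_iff) auto
    then show "g p \<in> plactic_ideal K n"
      unfolding I F g_def using p st
      by (auto simp: free intro!: single_diff_closed monoid_algebra_map_diff)
    show "g p \<noteq> (\<lambda>x. \<zero>\<^bsub>K\<^esub>)"
    proof
      assume "g p = (\<lambda>x. \<zero>\<^bsub>K\<^esub>)"
      then have "\<one>\<^bsub>K\<^esub> = \<zero>\<^bsub>K\<^esub>"
        unfolding g_def p(1) fst_conv snd_conv by (rule single_diff_zero[OF ne[symmetric] K.one_closed])
      then show False by simp
    qed
    show "leading_word K r (g p) = [fst p, snd p]"
      using st(3) ne
      by (intro leading_word_eq wf_lenlex_column_order[OF ord])
        (auto simp: g_def p single_diff_def K.single_def split: if_splits)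
  qed
  \<comment> \<open>Generation: modulo any ideal containing the g p, both words equal their
    tableaux, and congruent words have the same tableau.\<close>
  have diff_mem: "single_diff k u v \<in> J" if J: "ideal J ?F" and G: "g ` D \<subseteq> J"
    and kuv: "k \<in> carrier K" "u \<in> lists ?C" "v \<in> lists ?C" "?h u = ?h v" for J k u v
  proof -
    interpret J: ideal J ?F by fact
    \<comment> \<open>The descent to a tableau is run again, now recording that every straightening
      step stays within one coset of J.\<close>
    have step: "\<exists>t\<in>lists ?C. tableau t \<and> (concat w, concat t) \<in> plactic_cong n \<and>
        (\<forall>k\<in>carrier K. single_diff k w t \<in> J)" if "w \<in> lists ?C" for w
      using wf_lenlex_column_order[OF ord] that
    proof (induction w rule: wf_induct_rule)
      case (less w)
      show ?case
      proof (cases "tableau w")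
        case True
        have "\<forall>k\<in>carrier K. single_diff k w w \<in> J"
          using additive_subgroup.zero_closed[OF J.additive_subgroup_axioms]
          by (simp add: single_diff_refl F zero_A)
        then show ?thesis
          using True less.prems presented_cong.refl[OF concat_columns[OF less.prems]] by blast
      next
        case False
        then obtain p \<alpha> \<beta> q where w: "w = p @ [\<alpha>, \<beta>] @ q" "\<not> tableau_pair \<alpha> \<beta>"
          "p \<in> lists ?C" "q \<in> lists ?C" "\<alpha> \<in> ?C" "\<beta> \<in> ?C"
          using not_tableauE[OF less.prems] by blast
        define w' where "w' = p @ straighten \<alpha> \<beta> @ q"
        note st = straighten_columns[OF w(5,6,2)]
        have w': "w' \<in> lists ?C" "(w', w) \<in> lenlex r" "(concat w, concat w') \<in> plactic_cong n"
          using st straighten_lenlex[OF ord w(5,6,2)]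
            straighten_step[OF w(5,6,2)] w by (auto simp: w'_def)
        obtain t where t: "t \<in> lists ?C" "tableau t" "(concat w', concat t) \<in> plactic_cong n"
          "\<forall>k\<in>carrier K. single_diff k w' t \<in> J"
          using less.IH[OF w'(2,1)] by blast
        have "single_diff k w t \<in> J" if k: "k \<in> carrier K" for k
        proof (rule single_diff_trans_mem[of _ _ _ w'])
          have "g (\<alpha>, \<beta>) \<in> J" using G w by (auto simp: D_def)
          \<comment> \<open>A straightening inside the context p, q changes k w by the two-sided
            multiple k p g q of the basis element for the pair.\<close>
          then have "K.single k p \<otimes>\<^bsub>?F\<^esub> g (\<alpha>, \<beta>) \<otimes>\<^bsub>?F\<^esub> K.single \<one>\<^bsub>K\<^esub> q \<in> J"
            using k w
            by (intro J.I_r_closed[OF J.I_l_closed]) (auto simp: F free intro!: single_closed)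
          then show "single_diff k w w' \<in> J"
            using single_diff_mult[of k "[\<alpha>, \<beta>]" "straighten \<alpha> \<beta>" p q] k w st
            by (simp add: F free g_def w'_def)
        qed (use J t k in \<open>simp_all add: F\<close>)
        then show ?thesis using t(1,2) presented_cong.trans[OF w'(3) t(3)] by blast
      qed
    qed
    obtain s where s: "s \<in> lists ?C" "tableau s" "(concat u, concat s) \<in> plactic_cong n"
      "single_diff k u s \<in> J"
      using step[OF kuv(2)] kuv(1) by blast
    \<comment> \<open>The coefficient -k reverses the path: -k (v - t) = k (t - v), which continues
      k (u - s) to v once s = t.\<close>
    obtain t where t: "t \<in> lists ?C" "tableau t" "(concat v, concat t) \<in> plactic_cong n"
      "single_diff (\<ominus>\<^bsub>K\<^esub> k) v t \<in> J"
      using step[OF kuv(3)] kuv(1) by blast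
    have "(concat u, concat v) \<in> plactic_cong n" using kuv by (simp add: column_eval_eq_iff)
    then have "(concat s, concat t) \<in> plactic_cong n"
      using s(3) t(3) by (blast intro: presented_cong.sym presented_cong.trans)
    then have "s = t" using s t tableau_unique by blast
    then show "single_diff k u v \<in> J"
      using s(4) t(4) J kuv(1) by (intro single_diff_trans_mem[of J k u s v]) (auto simp: F single_diff_minus)
  qed
  have gen: "Idl\<^bsub>?F\<^esub> (g ` D) = plactic_ideal K n"
  proof
    show "Idl\<^bsub>?F\<^esub> (g ` D) \<subseteq> plactic_ideal K n"
      by (rule F.genideal_minimal[OF ideal_I image_subsetI[OF gD(1)]])
    have sub: "g ` D \<subseteq> carrier ?F"
    proof (rule image_subsetI)
      fix p assume "p \<in> D"
      then show "g p \<in> carrier ?F" using gD(1)[of p] unfolding I by simp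
    qed
    show "plactic_ideal K n \<subseteq> Idl\<^bsub>?F\<^esub> (g ` D)"
    proof
      fix f assume "f \<in> plactic_ideal K n"
      then have f: "f \<in> carrier A" "monoid_algebra_map K ?h f = (\<lambda>x. \<zero>\<^bsub>K\<^esub>)"
        unfolding I F by auto
      have J: "ideal (Idl\<^bsub>?F\<^esub> (g ` D)) A" using F.genideal_ideal[OF sub] by (simp only: F)
      show "f \<in> Idl\<^bsub>?F\<^esub> (g ` D)"
      proof (rule kernel_subset[OF J _ f])
        fix k u v
        assume "k \<in> carrier K" "u \<in> carrier (free_monoid ?C)" "v \<in> carrier (free_monoid ?C)" "?h u = ?h v"
        then show "single_diff k u v \<in> Idl\<^bsub>?F\<^esub> (g ` D)"
          unfolding free by (rule diff_mem[OF F.genideal_ideal[OF sub] F.genideal_self[OF sub]])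
      qed
    qed
  qed
  have lead: "\<exists>p\<in>D. sublist (leading_word K r (g p)) (leading_word K r f)"
    if f: "f \<in> plactic_ideal K n" "f \<noteq> \<zero>\<^bsub>?F\<^esub>" for f
  proof -
    have fA: "f \<in> carrier A" "monoid_algebra_map K ?h f = (\<lambda>x. \<zero>\<^bsub>K\<^esub>)"
      using f(1) unfolding I F by simp_all
    have supp: "{x. f x \<noteq> \<zero>\<^bsub>K\<^esub>} \<subseteq> lists ?C" (is "?W \<subseteq> _")
      using fA(1) by (simp add: carrier_A free)
    have ne: "?W \<noteq> {}" using f(2) by (simp add: F zero_A fun_eq_iff)
    obtain w where w: "f w \<noteq> \<zero>\<^bsub>K\<^esub>" "\<And>v. f v \<noteq> \<zero>\<^bsub>K\<^esub> \<Longrightarrow> v \<noteq> w \<Longrightarrow> (v, w) \<in> lenlex r"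
      by (rule bexE[OF ex_greatest_word[OF ord K.finsuppD(2)[OF A_finsupp[OF fA(1)]] ne supp]]) simp
    have lw: "leading_word K r f = w"
      using w by (intro leading_word_eq wf_lenlex_column_order[OF ord])
    \<comment> \<open>Cancellation in the fibre of w needs a second support word v. It lies below
      the leading word w, so w is not minimal in its class and cannot be a tableau.\<close>
    obtain v where v: "f v \<noteq> \<zero>\<^bsub>K\<^esub>" "v \<noteq> w" "?h v = ?h w"
      using kernel_support[OF fA w(1)] by blast
    have wv: "w \<in> lists ?C" "v \<in> lists ?C" using supp w(1) v(1) by auto
    have "(concat v, concat w) \<in> plactic_cong n" using v(3) wv by (simp add: column_eval_eq_iff)
    then have nt: "\<not> tableau w"
      using tableau_minimal[OF ord wv(1) _ wv(2)] w(2)[OF v(1,2)] by blast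
    obtain p \<alpha> \<beta> q where w_eq: "w = p @ [\<alpha>, \<beta>] @ q"
      and "\<not> tableau_pair \<alpha> \<beta>" "p \<in> lists ?C" "q \<in> lists ?C" "\<alpha> \<in> ?C" "\<beta> \<in> ?C"
      by (rule not_tableauE[OF wv(1) nt])
    then have mem: "(\<alpha>, \<beta>) \<in> D" by (simp add: D_def)
    have "sublist (leading_word K r (g (\<alpha>, \<beta>))) w"
      unfolding gD(3)[OF mem] w_eq fst_conv snd_conv by (rule sublist_appendI)
    then show ?thesis unfolding lw by (rule bexI[OF _ mem])
  qed
  have "finite D" using finite_columns[of n] by (auto simp: D_def)
  moreover have "groebner_shirshov_basis K n r (g ` D)"
    unfolding groebner_shirshov_basis_def
  proof (intro conjI ballI impI)
    show "g ` D \<subseteq> plactic_ideal K n" using gD(1) by (rule image_subsetI)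
    show "\<zero>\<^bsub>?F\<^esub> \<notin> g ` D"
    proof
      assume "\<zero>\<^bsub>?F\<^esub> \<in> g ` D"
      then obtain p where p: "\<zero>\<^bsub>?F\<^esub> = g p" "p \<in> D" by (rule imageE)
      show False using gD(2)[OF p(2)] unfolding p(1)[symmetric] by (simp add: F zero_A)
    qed
    fix f assume f: "f \<in> plactic_ideal K n" "f \<noteq> \<zero>\<^bsub>?F\<^esub>"
    obtain p where "p \<in> D" "sublist (leading_word K r (g p)) (leading_word K r f)"
      by (rule bexE[OF lead[OF f]])
    then show "\<exists>h\<in>g ` D. sublist (leading_word K r h) (leading_word K r f)"
      by (intro bexI[of _ "g p"] imageI)
  qed (rule gen)
  ultimately show ?thesis by blast
qed

end
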